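(* Let $n\geq 2$, $1\leq k\leq n-1$, and let $X\subset \mathbb{R}^n$ be Borel. Suppose there exists a $k$-plane $H \in \mathcal A(n,k)$ such that $\dim (X\setminus H) < \dim X$, and let $0 < t \leq \dim X$ be such that $\dim (X\setminus P) \geq t$ for all $P \in\mathcal A(n,k)$. Then $$\dim \mathcal L(X) \geq \dim X + t.$$
   Context: $\dim$ denotes Hausdorff dimension. $\mathcal A(n,k)$ is the set of $k$-dimensional affine planes in $\mathbb{R}^n$, equipped with the metric $d(U,U')=\lVert P_W-P_{W'}\rVert_{\mathrm{op}}+|x-x'|$, where $U=W+x$ and $U'=W'+x'$ with $W,W'$ $k$-dimensional linear subspaces, $x\in W^\perp$, $x'\in(W')^\perp$, and $P_W$ is orthogonal projection onto $W$. $\mathcal L(X):=\{\ell\in\mathcal A(n,1): |X\cap\ell|\geq 2\}$ is the set of affine lines containing at least two points of $X$; its Hausdorff dimension is taken with respect to the metric $d(\ell,\ell')=\lVert P_W-P_{W'}\rVert_{\mathrm{op}}+|x-x'|$ on $\mathcal A(n,1)$, where $\ell=W+x$ and $\ell'=W'+x'$ with $W,W'$ one-dimensional linear subspaces, $x\in W^\perp$, $x'\in(W')^\perp$. *)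

theory Defs
  imports "HOL-Analysis.Analysis"
begin

section \<open>Hausdorff dimension with respect to an explicit metric\<close>

text \<open>The metric \<open>d\<close> is an explicit argument because the definitions are used both for \<open>dist\<close> and for
  a metric on a set of affine planes. Everything below depends only on the values of \<open>d\<close> on \<open>E\<close>:
  intersecting the covering sets with \<open>E\<close> does not increase any diameter. So \<open>d\<close> need not be a
  metric outside the metric space containing \<open>E\<close>.\<close>

definition mdiam :: "('a \<Rightarrow> 'a \<Rightarrow> real) \<Rightarrow> 'a set \<Rightarrow> real" where
  "mdiam d U = (if U = {} then 0 else SUP (x, y) \<in> U \<times> U. d x y)"

text \<open>\<open>(diam U)\<^sup>s\<close>, with the convention \<open>0\<^sup>0 = 1\<close> for nonempty \<open>U\<close> (whereas \<open>0 powr 0 = 0\<close>),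
  so that the measure of exponent \<open>0\<close> is counting measure.\<close>

definition diam_pow :: "('a \<Rightarrow> 'a \<Rightarrow> real) \<Rightarrow> real \<Rightarrow> 'a set \<Rightarrow> ennreal" where
  "diam_pow d s U =
    (if U = {} then 0 else if s = 0 then 1 else ennreal (mdiam d U powr s))"

definition delta_covers ::
  "('a \<Rightarrow> 'a \<Rightarrow> real) \<Rightarrow> real \<Rightarrow> 'a set \<Rightarrow> (nat \<Rightarrow> 'a set) set" where
  "delta_covers d \<delta> E =
    {U. E \<subseteq> (\<Union>i. U i) \<and> (\<forall>i. \<forall>x\<in>U i. \<forall>y\<in>U i. d x y \<le> \<delta>)}"

definition hausdorff_premeasure ::
  "('a \<Rightarrow> 'a \<Rightarrow> real) \<Rightarrow> real \<Rightarrow> real \<Rightarrow> 'a set \<Rightarrow> ennreal" where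
  "hausdorff_premeasure d s \<delta> E = (INF U \<in> delta_covers d \<delta> E. \<Sum>i. diam_pow d s (U i))"

definition hausdorff_measure :: "('a \<Rightarrow> 'a \<Rightarrow> real) \<Rightarrow> real \<Rightarrow> 'a set \<Rightarrow> ennreal" where
  "hausdorff_measure d s E = (SUP \<delta> \<in> {0<..}. hausdorff_premeasure d s \<delta> E)"

definition hausdorff_dim :: "('a \<Rightarrow> 'a \<Rightarrow> real) \<Rightarrow> 'a set \<Rightarrow> ennreal" where
  "hausdorff_dim d E = Inf {ennreal s | s. 0 \<le> s \<and> hausdorff_measure d s E = 0}"


section \<open>Affine planes and their metric\<close>

definition affine_planes :: "nat \<Rightarrow> 'a::euclidean_space set set" where
  "affine_planes k = {U. affine U \<and> aff_dim U = int k}"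

definition orth_proj :: "'a::euclidean_space set \<Rightarrow> 'a \<Rightarrow> 'a" where
  "orth_proj W v = (THE w. w \<in> W \<and> v - w \<in> W\<^sup>\<bottom>)"

definition plane_dir :: "'a::euclidean_space set \<Rightarrow> 'a set" where
  "plane_dir U = {u - v | u v. u \<in> U \<and> v \<in> U}"

definition plane_offset :: "'a::euclidean_space set \<Rightarrow> 'a" where
  "plane_offset U = (THE x. x \<in> U \<and> x \<in> (plane_dir U)\<^sup>\<bottom>)"

definition plane_dist :: "'a::euclidean_space set \<Rightarrow> 'a set \<Rightarrow> real" where
  "plane_dist U U' =
     onorm (\<lambda>v. orth_proj (plane_dir U) v - orth_proj (plane_dir U') v)
     + norm (plane_offset U - plane_offset U')"

definition lines_through_two_points :: "'a::euclidean_space set \<Rightarrow> 'a set set" where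
  "lines_through_two_points X =
    {l \<in> affine_planes 1. \<exists>x \<in> X \<inter> l. \<exists>y \<in> X \<inter> l. x \<noteq> y}"


subsection \<open>The decomposition of a plane as \<open>W + x\<close> with \<open>x\<close> orthogonal to \<open>W\<close>\<close>

lemma orth_proj_unique:
  assumes "subspace W" "w \<in> W" "v - w \<in> W\<^sup>\<bottom>" "w' \<in> W" "v - w' \<in> W\<^sup>\<bottom>"
  shows "w = w'"
proof -
  have "w - w' \<in> W" using assms by (simp add: subspace_diff)
  moreover have "w - w' \<in> W\<^sup>\<bottom>"
    using subspace_diff[OF subspace_orthogonal_comp assms(5) assms(3)] by simp
  ultimately have "orthogonal (w - w') (w - w')"
    by (auto simp: orthogonal_comp_def)
  then show ?thesis by (simp add: orthogonal_self)
qed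

lemma orth_proj_eqI:
  assumes "subspace W" "w \<in> W" "v - w \<in> W\<^sup>\<bottom>"
  shows "orth_proj W v = w"
  unfolding orth_proj_def
  using assms orth_proj_unique[OF assms(1)] by (intro the_equality conjI) (assumption+, blast)

lemma orth_proj:
  assumes "subspace W"
  shows "orth_proj W v \<in> W" "v - orth_proj W v \<in> W\<^sup>\<bottom>"
proof -
  have "v \<in> W + W\<^sup>\<bottom>" using subspace_sum_orthogonal_comp[OF assms] by simp
  then obtain w z where "w \<in> W" "z \<in> W\<^sup>\<bottom>" "v = w + z" by (auto simp: set_plus_def)
  then have "w \<in> W \<and> v - w \<in> W\<^sup>\<bottom>" by simp
  then show "orth_proj W v \<in> W" "v - orth_proj W v \<in> W\<^sup>\<bottom>"
    using orth_proj_eqI[OF assms, of w v] by simp_all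
qed

lemma linear_orth_proj:
  assumes "subspace W"
  shows "linear (orth_proj W)"
proof (rule linearI)
  fix a b :: 'a and c :: real
  have "a + b - (orth_proj W a + orth_proj W b) \<in> W\<^sup>\<bottom>"
    using subspace_add[OF subspace_orthogonal_comp orth_proj(2)[OF assms, of a] orth_proj(2)[OF assms, of b]]
    by (simp add: algebra_simps)
  then show "orth_proj W (a + b) = orth_proj W a + orth_proj W b"
    by (intro orth_proj_eqI assms subspace_add orth_proj)
  have "c *\<^sub>R a - c *\<^sub>R orth_proj W a \<in> W\<^sup>\<bottom>"
    using subspace_scale[OF subspace_orthogonal_comp orth_proj(2)[OF assms, of a], of c]
    by (simp add: algebra_simps)
  then show "orth_proj W (c *\<^sub>R a) = c *\<^sub>R orth_proj W a"
    by (intro orth_proj_eqI assms subspace_scale orth_proj)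
qed

lemma plane_dir_translation:
  assumes "subspace W"
  shows "plane_dir ((+) x ` W) = W"
proof
  show "plane_dir ((+) x ` W) \<subseteq> W"
    using assms by (auto simp: plane_dir_def subspace_diff)
  show "W \<subseteq> plane_dir ((+) x ` W)"
  proof
    fix w assume "w \<in> W"
    then have "x + w \<in> (+) x ` W" "x + 0 \<in> (+) x ` W" "w = (x + w) - (x + 0)"
      using subspace_0[OF assms] by auto
    then show "w \<in> plane_dir ((+) x ` W)" unfolding plane_dir_def by blast
  qed
qed

lemma plane_offset_translation:
  assumes "subspace W" "x \<in> W\<^sup>\<bottom>"
  shows "plane_offset ((+) x ` W) = x"
  unfolding plane_offset_def plane_dir_translation[OF assms(1)]
proof (rule the_equality)
  show "x \<in> (+) x ` W \<and> x \<in> W\<^sup>\<bottom>"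
    using assms(2) imageI[OF subspace_0[OF assms(1)], of "(+) x"] by simp
  fix y assume y: "y \<in> (+) x ` W \<and> y \<in> W\<^sup>\<bottom>"
  then have "y - x \<in> W" by auto
  moreover have "y - x \<in> W\<^sup>\<bottom>"
    using y assms(2) subspace_diff[OF subspace_orthogonal_comp] by blast
  ultimately have "orthogonal (y - x) (y - x)"
    by (auto simp: orthogonal_comp_def)
  then show "y = x" by (simp add: orthogonal_self)
qed

theorem plane_dist_eq:
  assumes "subspace W" "x \<in> W\<^sup>\<bottom>" "subspace W'" "x' \<in> W'\<^sup>\<bottom>"
  shows "plane_dist ((+) x ` W) ((+) x' ` W') =
           onorm (\<lambda>v. orth_proj W v - orth_proj W' v) + norm (x - x')"
  using assms by (simp add: plane_dist_def plane_dir_translation plane_offset_translation)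

theorem affine_planes_iff:
  "U \<in> affine_planes k \<longleftrightarrow>
     (\<exists>W x. subspace W \<and> dim W = k \<and> x \<in> W\<^sup>\<bottom> \<and> U = (+) x ` W)"
proof
  assume "U \<in> affine_planes k"
  then have U: "affine U" "aff_dim U = int k" by (auto simp: affine_planes_def)
  then have "U \<noteq> {}" using aff_dim_empty[of U] by linarith
  from ex1_implies_ex[OF affine_parallel_subspace[OF U(1) this]]
  obtain W where W: "subspace W" and "affine_parallel U W" by (elim exE conjE)
  then have "affine_parallel W U" by (metis affine_parallel_commute)
  then obtain a where a: "U = (+) a ` W" unfolding affine_parallel_def by (rule exE)
  have "dim W = k"
    using U(2) aff_dim_translation_eq[of a W] aff_dim_subspace[OF W] unfolding a by simp
  define x where "x = a - orth_proj W a"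
  have "U = (+) x ` W"
  proof
    show "U \<subseteq> (+) x ` W"
    proof
      fix u assume "u \<in> U"
      then obtain w where "w \<in> W" "u = a + w" using a by auto
      then have "u = x + (orth_proj W a + w)" "orth_proj W a + w \<in> W"
        using W orth_proj(1)[OF W] by (auto simp: x_def subspace_add)
      then show "u \<in> (+) x ` W" by blast
    qed
    show "(+) x ` W \<subseteq> U"
    proof
      fix u assume "u \<in> (+) x ` W"
      then obtain w where "w \<in> W" "u = x + w" by auto
      then have "u = a + (w - orth_proj W a)" "w - orth_proj W a \<in> W"
        using W orth_proj(1)[OF W] by (auto simp: x_def subspace_diff)
      then show "u \<in> U" using a by blast
    qed
  qed
  then show "\<exists>W x. subspace W \<and> dim W = k \<and> x \<in> W\<^sup>\<bottom> \<and> U = (+) x ` W"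
    using W \<open>dim W = k\<close> orth_proj(2)[OF W, of a] unfolding x_def by (intro exI conjI)
next
  assume "\<exists>W x. subspace W \<and> dim W = k \<and> x \<in> W\<^sup>\<bottom> \<and> U = (+) x ` W"
  then obtain W x where W: "subspace W" "dim W = k" and U: "U = (+) x ` W" by blast
  have "affine U"
    unfolding U using iffD1[OF affine_translation subspace_imp_affine[OF W(1)]] .
  moreover have "aff_dim U = int k"
    using aff_dim_translation_eq[of x W] aff_dim_subspace[OF W(1)] W(2) unfolding U by simp
  ultimately show "U \<in> affine_planes k" by (simp add: affine_planes_def)
qed

lemma subspace_plane_dir:
  assumes "U \<in> affine_planes k"
  shows "subspace (plane_dir U)"
proof -
  obtain W x where "subspace W" "U = (+) x ` W"
    using iffD1[OF affine_planes_iff assms] by blast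
  then show ?thesis by (simp add: plane_dir_translation)
qed

lemma plane_eq_translation:
  assumes "U \<in> affine_planes k"
  shows "U = (+) (plane_offset U) ` plane_dir U"
proof -
  obtain W x where "subspace W" "x \<in> W\<^sup>\<bottom>" "U = (+) x ` W"
    using iffD1[OF affine_planes_iff assms] by blast
  then show ?thesis by (simp add: plane_dir_translation plane_offset_translation)
qed

lemma bounded_linear_orth_proj_diff:
  assumes "subspace W" "subspace W'"
  shows "bounded_linear (\<lambda>v. orth_proj W v - orth_proj W' v)"
  using linear_compose_sub[OF linear_orth_proj[OF assms(1)] linear_orth_proj[OF assms(2)]]
  by (simp add: linear_conv_bounded_linear)

lemma orth_proj_eq_self_iff:
  assumes "subspace W"
  shows "orth_proj W v = v \<longleftrightarrow> v \<in> W"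
proof
  assume "orth_proj W v = v"
  then show "v \<in> W" using orth_proj(1)[OF assms, of v] by simp
next
  assume "v \<in> W"
  then show "orth_proj W v = v"
    using subspace_0[OF subspace_orthogonal_comp[of W]] by (intro orth_proj_eqI assms) auto
qed

theorem plane_dist_metric:
  fixes U V T :: "'a::euclidean_space set"
  assumes "U \<in> affine_planes k" "V \<in> affine_planes k" "T \<in> affine_planes k"
  shows plane_dist_nonneg: "0 \<le> plane_dist U V"
    and plane_dist_commute: "plane_dist U V = plane_dist V U"
    and plane_dist_eq_0_iff: "plane_dist U V = 0 \<longleftrightarrow> U = V"
    and plane_dist_triangle: "plane_dist U V \<le> plane_dist U T + plane_dist T V"
proof -
  note s = assms[THEN subspace_plane_dir]
  note UV = bounded_linear_orth_proj_diff[OF s(1) s(2)]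
  show "0 \<le> plane_dist U V"
    unfolding plane_dist_def using onorm_pos_le[OF UV] by simp
  show "plane_dist U V = plane_dist V U"
    unfolding plane_dist_def onorm_def by (simp add: norm_minus_commute)
  show "plane_dist U V = 0 \<longleftrightarrow> U = V"
  proof
    assume "plane_dist U V = 0"
    then have *: "onorm (\<lambda>v. orth_proj (plane_dir U) v - orth_proj (plane_dir V) v) = 0"
      "norm (plane_offset U - plane_offset V) = 0"
      unfolding plane_dist_def using onorm_pos_le[OF UV] by (simp_all add: add_nonneg_eq_0_iff)
    then have "orth_proj (plane_dir U) v = orth_proj (plane_dir V) v" for v
      using onorm_eq_0[OF UV] by simp
    then have "plane_dir U = plane_dir V"
      using orth_proj_eq_self_iff[OF s(1)] orth_proj_eq_self_iff[OF s(2)] by auto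
    then show "U = V"
      using * plane_eq_translation[OF assms(1)] plane_eq_translation[OF assms(2)] by simp
  next
    assume "U = V"
    then show "plane_dist U V = 0" by (simp add: plane_dist_def onorm_zero)
  qed
  show "plane_dist U V \<le> plane_dist U T + plane_dist T V"
    unfolding plane_dist_def
    using onorm_triangle[OF bounded_linear_orth_proj_diff[OF s(1) s(3)]
        bounded_linear_orth_proj_diff[OF s(3) s(2)]]
      norm_triangle_ineq[of "plane_offset U - plane_offset T" "plane_offset T - plane_offset V"]
    by simp
qed

end

theory Submission
  imports Defs
begin

text \<open>Put \<open>A = X \<inter> H\<close> and \<open>B = X - H\<close>, so that \<open>dim A = dim X > dim B \<ge> t\<close>. A part of \<open>B\<close> of almost full dimension lies
  strictly on one side of a hyperplane \<open>{x. e \<bullet> x = h}\<close> containing \<open>H\<close>, and the line through \<open>a \<in> A\<close> and such a \<open>b\<close> is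
  determined by \<open>a\<close> and its direction, which are Lipschitz functions of the line. Since \<open>dim A > t\<close>, Kaufman's energy
  argument for projections shows that for most \<open>a\<close> the directions from \<open>a\<close> to \<open>B\<close> have dimension at least
  \<open>t\<close> in a quantitative way, which gives lines of dimension at least \<open>dim A + t\<close>. Instead of measures, the argument uses
  finite Frostman weights at a small scale: compactness makes every cover finite, so a scale below all
  of its diameters suffices. Compact subsets of a Borel set come from the capacitability of a dyadic Hausdorff content.\<close>

text \<open>The obstacle is that a radial projection is not linear in \<open>b\<close>. Seen from a
  hyperplane it becomes linear: put \<open>\<beta> = e \<bullet> b - h\<close>,
  \<open>u = b / \<beta>\<close> and \<open>w = 1 / \<beta>\<close>. The direction from
  \<open>a\<close>, normalised by \<open>e \<bullet> v = 1\<close>, is then \<open>u - w a\<close>,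
  the linear projection of \<open>(u, w)\<close> with kernel spanned by \<open>(a, 1)\<close>. So
  the points of the hyperplane parametrise a family of linear projections, and two given points look
  almost the same only from \<open>a\<close> close to a single point \<open>z\<close>. Averaging
  \<open>dist a z powr (- q)\<close> over a mass of exponent \<open>p\<close> stays bounded for
  \<open>q < p\<close>; this is what \<open>dim A > t\<close> provides. A set of diameter
  \<open>r\<close> in the space of pairs (point, direction) then carries mass of order at most
  \<open>r powr p * r powr q\<close>, whence the sum of the two dimensions. Neither
  \<open>dim X\<close> nor \<open>t\<close> need be attained by a Frostman mass, so the proof is by
  contradiction: if the lines had smaller dimension, there would be room for
  \<open>p < dim X\<close> and \<open>q < t\<close> with \<open>p + q\<close> still above
  it.\<close>

section \<open>Null sets of a Hausdorff measure\<close>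

text \<open>The \<open>r i\<close> are only upper bounds for the diameters, so that no supremum has to be taken.\<close>

definition hcover :: "('a \<Rightarrow> 'a \<Rightarrow> real) \<Rightarrow> real \<Rightarrow> 'a set \<Rightarrow> real \<Rightarrow> (nat \<Rightarrow> 'a set) \<Rightarrow> (nat \<Rightarrow> real) \<Rightarrow> bool" where
  "hcover d p E \<epsilon> U r \<longleftrightarrow> E \<subseteq> (\<Union>i. U i) \<and> (\<forall>i. 0 \<le> r i) \<and>
     (\<forall>i. \<forall>x\<in>U i. \<forall>y\<in>U i. d x y \<le> r i) \<and> (\<Sum>i. ennreal (r i powr p)) \<le> ennreal \<epsilon>"

definition hnull :: "('a \<Rightarrow> 'a \<Rightarrow> real) \<Rightarrow> real \<Rightarrow> 'a set \<Rightarrow> bool" where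
  "hnull d p E \<longleftrightarrow> (\<forall>\<epsilon>>0. \<exists>U r. hcover d p E \<epsilon> U r)"

lemma hcoverD:
  assumes "hcover d p E \<epsilon> U r"
  shows "E \<subseteq> (\<Union>i. U i)" "0 \<le> r i" "x \<in> U i \<Longrightarrow> y \<in> U i \<Longrightarrow> d x y \<le> r i"
    "(\<Sum>i. ennreal (r i powr p)) \<le> ennreal \<epsilon>"
  using assms unfolding hcover_def by auto

lemma hcoverI:
  assumes "E \<subseteq> (\<Union>i. U i)" "\<And>i. 0 \<le> r i" "\<And>i x y. x \<in> U i \<Longrightarrow> y \<in> U i \<Longrightarrow> d x y \<le> r i"
    "(\<Sum>i. ennreal (r i powr p)) \<le> ennreal \<epsilon>"
  shows "hcover d p E \<epsilon> U r"
  using assms unfolding hcover_def by auto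

lemma ennreal_le_suminf: "f i \<le> (\<Sum>i. f i :: ennreal)"
  using sum_le_suminf[of f "{i}"] by simp

lemma powr_le_imp_le_root:
  fixes r p e :: real
  assumes "0 < p" "0 \<le> r" "0 < e" "r powr p \<le> e powr p"
  shows "r \<le> e"
  using assms powr_less_mono2[of p e r] by force

text \<open>A total of at most \<open>\<delta> powr p\<close> forces every single radius below
  \<delta>, so the covers with arbitrarily small total are already \<delta>-covers.\<close>

lemma hnull_imp_hausdorff_measure_0:
  assumes "hnull d p E" "0 < p" and nn: "\<And>x y. 0 \<le> d x y"
  shows "hausdorff_measure d p E = 0"
proof -
  have "hausdorff_premeasure d p \<delta> E \<le> ennreal \<epsilon>" if "0 < \<delta>" "0 < \<epsilon>" for \<delta> \<epsilon> :: real
  proof -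
    define \<eta> where "\<eta> = min \<epsilon> (\<delta> powr p)"
    have "0 < \<eta>" using that by (simp add: \<eta>_def)
    then obtain U r where "hcover d p E \<eta> U r"
    using assms(1) unfolding hnull_def by blast
  note U = hcoverD[OF this]
    have "r i \<le> \<delta>" for i
    proof -
      have "ennreal (r i powr p) \<le> ennreal \<eta>"
        using ennreal_le_suminf[of "\<lambda>i. ennreal (r i powr p)" i] U(4) by (rule order_trans)
      then have "r i powr p \<le> \<eta>" using \<open>0 < \<eta>\<close> by simp
      then show ?thesis
        using powr_le_imp_le_root[OF assms(2) U(2)[of i] that(1)] by (simp add: \<eta>_def)
    qed
    then have "U \<in> delta_covers d \<delta> E"
      using U(1) order_trans[OF U(3)] unfolding delta_covers_def by blast
    then have "hausdorff_premeasure d p \<delta> E \<le> (\<Sum>i. diam_pow d p (U i))"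
      unfolding hausdorff_premeasure_def by (rule INF_lower)
    also have "\<dots> \<le> (\<Sum>i. ennreal (r i powr p))"
    proof (rule suminf_le)
      fix i
      show "diam_pow d p (U i) \<le> ennreal (r i powr p)"
      proof (cases "U i = {}")
        case False
        then obtain x where x: "x \<in> U i" by blast
        have "(SUP (x, y) \<in> U i \<times> U i. d x y) \<le> r i"
          using x U(3) by (intro cSUP_least) auto
        \<comment> \<open>Powers are monotone on nonnegative bases only, so the supremum also needs
          a lower bound.\<close>
        moreover have "d x x \<le> (SUP (x, y) \<in> U i \<times> U i. d x y)"
          using x U(3) by (intro cSUP_upper2[where x="(x,x)"] bdd_aboveI2[where M="r i"]) auto
        ultimately show ?thesis
          using False assms(2) nn[of x x]
          by (auto simp: diam_pow_def mdiam_def intro!: ennreal_leI powr_mono2)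
      qed (simp add: diam_pow_def)
    qed simp_all
    also have "\<dots> \<le> ennreal \<eta>" by (rule U(4))
    also have "\<dots> \<le> ennreal \<epsilon>" by (simp add: \<eta>_def ennreal_leI)
    finally show ?thesis .
  qed
  note le = this
  have "hausdorff_premeasure d p \<delta> E \<le> 0" if "0 < \<delta>" for \<delta>
  proof (rule ennreal_le_epsilon)
    fix \<epsilon> :: real assume "0 < \<epsilon>"
    from le[OF \<open>0 < \<delta>\<close> this] show "hausdorff_premeasure d p \<delta> E \<le> 0 + ennreal \<epsilon>" by simp
  qed
  then have "hausdorff_measure d p E \<le> 0"
    unfolding hausdorff_measure_def by (intro SUP_least) simp
  then show ?thesis by simp
qed

lemma hausdorff_measure_0_imp_hnull:
  assumes "hausdorff_measure d p E = 0" "0 < p" and nn: "\<And>x. x \<in> E \<Longrightarrow> 0 \<le> d x x"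
  shows "hnull d p E"
  unfolding hnull_def
proof (intro allI impI)
  fix \<epsilon> :: real assume "0 < \<epsilon>"
  have "hausdorff_premeasure d p 1 E \<le> hausdorff_measure d p E"
    unfolding hausdorff_measure_def by (intro SUP_upper) simp
  then have "(INF U \<in> delta_covers d 1 E. \<Sum>i. diam_pow d p (U i)) < ennreal \<epsilon>"
    using assms(1) \<open>0 < \<epsilon>\<close> by (simp add: hausdorff_premeasure_def)
  then obtain U where U: "U \<in> delta_covers d 1 E" "(\<Sum>i. diam_pow d p (U i)) < ennreal \<epsilon>"
    unfolding INF_less_iff by blast
  \<comment> \<open>\<open>d\<close> is known to be nonnegative on the diagonal of \<open>E\<close>
    only. A covering set that misses \<open>E\<close> might have negative \<open>mdiam\<close>, so
    it is emptied and given radius 0.\<close>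
  define V where "V i = U i \<inter> E" for i
  define r where "r i = (if V i = {} then 0 else mdiam d (U i))" for i
  have bd: "d x y \<le> mdiam d (U i)" if "x \<in> U i" "y \<in> U i" for x y i
  proof -
    have "bdd_above ((\<lambda>(x, y). d x y) ` (U i \<times> U i))"
      using U(1) by (intro bdd_aboveI2[where M=1]) (auto simp: delta_covers_def)
    then have "d x y \<le> (SUP (x, y) \<in> U i \<times> U i. d x y)"
      using that by (intro cSUP_upper2[where x="(x,y)"]) auto
    then show ?thesis using that by (auto simp: mdiam_def)
  qed
  have "0 \<le> r i" for i
  proof (cases "V i = {}")
    case False
    then obtain x where "x \<in> U i" "x \<in> E" by (auto simp: V_def)
    then show ?thesis using bd[of x i x] nn[of x] False by (simp add: r_def)
  qed (simp add: r_def)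
  moreover have "E \<subseteq> (\<Union>i. V i)" using U(1) by (auto simp: V_def delta_covers_def)
  moreover have "d x y \<le> r i" if "x \<in> V i" "y \<in> V i" for x y i
    using bd that by (auto simp: r_def V_def)
  moreover have "(\<Sum>i. ennreal (r i powr p)) \<le> (\<Sum>i. diam_pow d p (U i))"
    using assms(2) by (intro suminf_le) (auto simp: r_def V_def diam_pow_def)
  then have "(\<Sum>i. ennreal (r i powr p)) \<le> ennreal \<epsilon>" using U(2) by simp
  ultimately have "hcover d p E \<epsilon> V r" by (intro hcoverI)
  then show "\<exists>U r. hcover d p E \<epsilon> U r" by blast
qed

lemma hnull_mono_exponent:
  assumes "hnull d p E" "0 < p" "p \<le> p'"
  shows "hnull d p' E"
  unfolding hnull_def
proof (intro allI impI)
  fix \<epsilon> :: real assume "0 < \<epsilon>"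
  \<comment> \<open>A total of at most 1 forces all radii into the unit interval, where powers
    decrease with the exponent.\<close>
  then have "0 < min \<epsilon> 1" by simp
  then obtain U r where "hcover d p E (min \<epsilon> 1) U r"
    using assms(1) unfolding hnull_def by blast
  note U = hcoverD[OF this]
  have "r i \<le> 1" for i
  proof -
    have "ennreal (r i powr p) \<le> ennreal (min \<epsilon> 1)"
      using ennreal_le_suminf[of "\<lambda>i. ennreal (r i powr p)" i] U(4) by (rule order_trans)
    then have "r i powr p \<le> 1 powr p" using \<open>0 < min \<epsilon> 1\<close> ennreal_le_iff[of "min \<epsilon> 1"] by simp
    then show ?thesis using powr_le_imp_le_root[OF assms(2) U(2)[of i], of 1] by simp
  qed
  then have "r i powr p' \<le> r i powr p" for i
    using U(2)[of i] assms(3) by (intro powr_mono') auto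
  then have "(\<Sum>i. ennreal (r i powr p')) \<le> (\<Sum>i. ennreal (r i powr p))"
    by (intro suminf_le) (auto intro: ennreal_leI)
  also have "\<dots> \<le> ennreal \<epsilon>"
    using U(4) by (rule order_trans) (simp add: ennreal_leI)
  finally have "hcover d p' E \<epsilon> U r" using U(1-3) by (intro hcoverI)
  then show "\<exists>U r. hcover d p' E \<epsilon> U r" by blast
qed

lemma hnull_subset: "hnull d p E \<Longrightarrow> F \<subseteq> E \<Longrightarrow> hnull d p F"
  unfolding hnull_def hcover_def by (meson order_trans)

lemma hnull_UN:
  fixes E :: "nat \<Rightarrow> 'a set"
  assumes "\<And>j. hnull d p (E j)"
  shows "hnull d p (\<Union>j. E j)"
  unfolding hnull_def
proof (intro allI impI)
  fix \<epsilon> :: real assume "0 < \<epsilon>"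
  then have "\<exists>U r. hcover d p (E j) (\<epsilon> * (1/2) ^ Suc j) U r" for j
    using assms[of j] unfolding hnull_def by simp
  then obtain U r where "\<And>j. hcover d p (E j) (\<epsilon> * (1/2) ^ Suc j) (U j) (r j)" by metis
  note U = hcoverD[OF this]
  let ?U = "\<lambda>n. case_prod U (prod_decode n)" and ?r = "\<lambda>n. case_prod r (prod_decode n)"
  have "(\<Union>j. E j) \<subseteq> (\<Union>n. ?U n)"
  proof
    fix x assume "x \<in> (\<Union>j. E j)"
    then obtain j i where "x \<in> U j i" using U(1) by blast
    then have "x \<in> ?U (prod_encode (j, i))" by simp
    then show "x \<in> (\<Union>n. ?U n)" by (rule UN_I[OF UNIV_I])
  qed
  moreover have "0 \<le> ?r n" for n
    using U(2) by (simp split: prod.split)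
  moreover have "d x y \<le> ?r n" if "x \<in> ?U n" "y \<in> ?U n" for n x y
    using U(3) that by (simp split: prod.splits)
  moreover have "(\<Sum>n. ennreal (?r n powr p)) \<le> ennreal \<epsilon>"
  proof -
    have "(\<Sum>n. ennreal (?r n powr p)) = (\<Sum>n. (\<lambda>(j,i). ennreal (r j i powr p)) (prod_decode n))"
      by (intro suminf_cong) (auto split: prod.split)
    also have "\<dots> = (\<Sum>j. \<Sum>i. ennreal (r j i powr p))"
      by (intro suminf_ennreal_2dimen) simp
    also have "\<dots> \<le> (\<Sum>j. ennreal (\<epsilon> * (1/2) ^ Suc j))"
      by (intro suminf_le U(4)) simp_all
    also have "\<dots> = ennreal \<epsilon>"
      using sums_mult[OF power_half_series, of \<epsilon>] \<open>0 < \<epsilon>\<close>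
      by (intro suminf_ennreal_eq) auto
    finally show ?thesis .
  qed
  ultimately have "hcover d p (\<Union>j. E j) \<epsilon> ?U ?r" by (intro hcoverI)
  then show "\<exists>U r. hcover d p (\<Union>j. E j) \<epsilon> U r" by blast
qed

lemma hnull_empty: "0 < p \<Longrightarrow> hnull d p {}"
  unfolding hnull_def hcover_def by (intro allI impI exI[of _ "\<lambda>_. {}"] exI[of _ "\<lambda>_. 0"]) auto

lemma hnull_countable_UN:
  assumes "countable I" "\<And>j. j \<in> I \<Longrightarrow> hnull d p (E j)" "0 < p"
  shows "hnull d p (\<Union>j\<in>I. E j)"
proof (cases "I = {}")
  case False
  have "hnull d p (\<Union>n. E (from_nat_into I n))"
    using assms(2) from_nat_into[OF False] by (intro hnull_UN) auto
  moreover have "(\<Union>j\<in>I. E j) = (\<Union>n. E (from_nat_into I n))"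
    using range_from_nat_into[OF False assms(1)] by (metis image_image)
  ultimately show ?thesis by simp
qed (simp add: hnull_empty assms)

lemma hnull_Un:
  assumes "hnull d p E" "hnull d p F" "0 < p"
  shows "hnull d p (E \<union> F)"
  using hnull_countable_UN[of "{True, False}" d p "\<lambda>b. if b then E else F"] assms by (auto simp: Un_commute)

text \<open>With two maps on one parameter set, the Lipschitz map sending \<open>g x\<close> to
  \<open>f x\<close> never has to be constructed. Later the parameters are pairs of points,
  \<open>g\<close> gives the line and \<open>f\<close> the point and direction.\<close>

lemma hnull_image_lipschitz:
  assumes "hnull d p (g ` E)" "0 < p" "0 < L"
    and lip: "\<And>x y. x \<in> E \<Longrightarrow> y \<in> E \<Longrightarrow> d' (f x) (f y) \<le> L * d (g x) (g y)"
  shows "hnull d' p (f ` E)"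
  unfolding hnull_def
proof (intro allI impI)
  fix \<epsilon> :: real assume "0 < \<epsilon>"
  then have "0 < \<epsilon> / L powr p" using assms(3) by simp
  then obtain U r where "hcover d p (g ` E) (\<epsilon> / L powr p) U r"
    using assms(1) unfolding hnull_def by blast
  note U = hcoverD[OF this]
  define V where "V i = f ` {x\<in>E. g x \<in> U i}" for i
  have "d' x y \<le> L * r i" if xy: "x \<in> V i" "y \<in> V i" for x y i
  proof -
    obtain a where a: "a \<in> E" "g a \<in> U i" "x = f a" using xy(1) by (auto simp: V_def)
    obtain b where b: "b \<in> E" "g b \<in> U i" "y = f b" using xy(2) by (auto simp: V_def)
    have "d' x y \<le> L * d (g a) (g b)" unfolding a(3) b(3) by (rule lip[OF a(1) b(1)])
    also have "\<dots> \<le> L * r i" using U(3)[OF a(2) b(2)] assms(3) by simp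
    finally show ?thesis .
  qed
  moreover have "(\<Sum>i. ennreal ((L * r i) powr p)) \<le> ennreal \<epsilon>"
  proof -
    have "(\<Sum>i. ennreal ((L * r i) powr p)) = (\<Sum>i. ennreal (L powr p) * ennreal (r i powr p))"
      using U(2) assms(3) by (simp add: powr_mult ennreal_mult')
    also have "\<dots> = ennreal (L powr p) * (\<Sum>i. ennreal (r i powr p))"
      by simp
    also have "\<dots> \<le> ennreal (L powr p) * ennreal (\<epsilon> / L powr p)"
      by (intro mult_left_mono U(4)) simp
    also have "\<dots> = ennreal \<epsilon>"
      using assms(3) by (simp add: ennreal_mult'[symmetric])
    finally show ?thesis .
  qed
  moreover have "f ` E \<subseteq> (\<Union>i. V i)"
  proof
    fix y assume "y \<in> f ` E"
    then obtain x where "x \<in> E" "y = f x" by blast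
    moreover from \<open>x \<in> E\<close> obtain i where "g x \<in> U i" using U(1) by blast
    ultimately have "y \<in> V i" by (auto simp: V_def)
    then show "y \<in> (\<Union>i. V i)" by (rule UN_I[OF UNIV_I])
  qed
  moreover have "0 \<le> L * r i" for i using U(2) assms(3) by simp
  ultimately have "hcover d' p (f ` E) \<epsilon> V (\<lambda>i. L * r i)"
    by (intro hcoverI)
  then show "\<exists>U r. hcover d' p (f ` E) \<epsilon> U r" by blast
qed

text \<open>Half of \<epsilon> pays for the cover and half for a summable enlargement to open sets.
  The enlargement also makes each \<open>d i\<close> strictly positive, so that a finite subcover
  has a least one.\<close>

lemma hnull_open_cover:
  fixes E :: "'a::metric_space set"
  assumes "hnull dist p E" "0 < p" "0 < \<epsilon>"
  obtains G d where "E \<subseteq> (\<Union>i::nat. G i)" "\<And>i. open (G i)" "\<And>i. 0 < d i"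
    "\<And>i x y. x \<in> G i \<Longrightarrow> y \<in> G i \<Longrightarrow> dist x y \<le> d i"
    "\<And>I. finite I \<Longrightarrow> (\<Sum>i\<in>I. d i powr p) \<le> \<epsilon>"
proof -
  have "0 < \<epsilon> / 2" using assms(3) by simp
  then obtain U r where "hcover dist p E (\<epsilon> / 2) U r"
    using assms(1) unfolding hnull_def by blast
  note U = hcoverD[OF this]
  \<comment> \<open>The power is continuous from the right at \<open>r i\<close>, also when
    \<open>r i = 0\<close>, because \<open>0 < p\<close>.\<close>
  have "\<exists>\<rho>>0. (r i + 2 * \<rho>) powr p \<le> r i powr p + \<epsilon> / 2 * (1/2) ^ Suc i" for i
  proof -
    have "((\<lambda>\<rho>. (r i + 2 * \<rho>) powr p) \<longlongrightarrow> (r i + 2 * 0) powr p) (at_right 0)"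
      using assms(2) U(2)[of i]
      by (intro tendsto_powr' tendsto_intros) (auto simp: eventually_at_filter)
    then have "\<forall>\<^sub>F \<rho> in at_right 0. (r i + 2 * \<rho>) powr p < r i powr p + \<epsilon> / 2 * (1/2) ^ Suc i"
      using assms(3) by (intro order_tendstoD) auto
    then have "\<forall>\<^sub>F \<rho> in at_right (0::real). 0 < \<rho> \<and> (r i + 2 * \<rho>) powr p \<le> r i powr p + \<epsilon> / 2 * (1/2) ^ Suc i"
      using eventually_at_right_less[of "0::real"] by eventually_elim auto
    then show ?thesis using eventually_happens[of _ "at_right (0::real)"] by force
  qed
  then obtain \<rho> where \<rho>: "\<And>i. 0 < \<rho> i"
    "\<And>i. (r i + 2 * \<rho> i) powr p \<le> r i powr p + \<epsilon> / 2 * (1/2) ^ Suc i" by metis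
  define G where "G i = (\<Union>x\<in>U i. ball x (\<rho> i))" for i
  show thesis
  proof (rule that[of G "\<lambda>i. r i + 2 * \<rho> i"])
    show "E \<subseteq> (\<Union>i. G i)"
    proof
      fix x assume "x \<in> E"
      then obtain i where "x \<in> U i" using U(1) by blast
      then have "x \<in> G i" using \<rho>(1)[of i] by (force simp: G_def)
      then show "x \<in> (\<Union>i. G i)" by blast
    qed
    show "open (G i)" for i by (auto simp: G_def)
    show "0 < r i + 2 * \<rho> i" for i using \<rho>(1)[of i] U(2)[of i] by simp
    show "dist x y \<le> r i + 2 * \<rho> i" if xy: "x \<in> G i" "y \<in> G i" for i x y
    proof -
      obtain a b where "a \<in> U i" "b \<in> U i" "dist a x < \<rho> i" "dist b y < \<rho> i"
        using xy by (auto simp: G_def)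
      moreover have "dist x y \<le> dist a x + dist a b + dist b y"
        by metric
      ultimately show ?thesis using U(3)[of a i b] by simp
    qed
    show "(\<Sum>i\<in>I. (r i + 2 * \<rho> i) powr p) \<le> \<epsilon>" if "finite I" for I
    proof -
      have "(\<Sum>i\<in>I. (r i + 2 * \<rho> i) powr p) \<le> (\<Sum>i\<in>I. r i powr p) + (\<Sum>i\<in>I. \<epsilon> / 2 * (1/2) ^ Suc i)"
        unfolding sum.distrib[symmetric] by (intro sum_mono \<rho>(2))
      moreover have "(\<Sum>i\<in>I. r i powr p) \<le> \<epsilon> / 2"
      proof -
        have "ennreal (\<Sum>i\<in>I. r i powr p) = (\<Sum>i\<in>I. ennreal (r i powr p))" by simp
        also have "\<dots> \<le> (\<Sum>i. ennreal (r i powr p))"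
          using that by (intro sum_le_suminf) auto
        also note U(4)
        finally show ?thesis using assms(3) by simp
      qed
      moreover have "(\<Sum>i\<in>I. \<epsilon> / 2 * (1/2) ^ Suc i) \<le> \<epsilon> / 2"
      proof -
        have "(\<lambda>i. \<epsilon> / 2 * (1/2) ^ Suc i) sums (\<epsilon> / 2 * 1)"
          by (rule sums_mult[OF power_half_series])
        then show ?thesis
          using sum_le_suminf[of "\<lambda>i. \<epsilon> / 2 * (1/2) ^ Suc i" I] that assms(3)
          by (auto simp: sums_iff)
      qed
      ultimately show ?thesis by simp
    qed
  qed
qed

lemma hausdorff_dim_le_if_hnull:
  assumes "hnull dist p E" "0 < p"
  shows "hausdorff_dim dist E \<le> ennreal p"
  unfolding hausdorff_dim_def
  using hnull_imp_hausdorff_measure_0[OF assms] assms(2) by (intro Inf_lower) auto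

lemma hnull_if_hausdorff_dim_less:
  assumes "hausdorff_dim d E < ennreal p" and nn: "\<And>x. x \<in> E \<Longrightarrow> 0 \<le> d x x"
  shows "hnull d p E"
proof -
  obtain s where s: "0 \<le> s" "hausdorff_measure d s E = 0" "s < p"
    using assms(1) unfolding hausdorff_dim_def Inf_less_iff by (auto simp: ennreal_less_iff)
  show ?thesis
  proof (cases "s = 0")
    \<comment> \<open>At exponent 0 each nonempty covering set counts 1, so a total below 1 leaves
      only empty sets.\<close>
    case True
    have "hausdorff_premeasure d 0 1 E \<le> hausdorff_measure d 0 E"
      unfolding hausdorff_measure_def by (intro SUP_upper) simp
    then have "(INF U \<in> delta_covers d 1 E. \<Sum>i. diam_pow d 0 (U i)) < 1"
      using s(2) True by (simp add: hausdorff_premeasure_def)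
    then obtain U where U: "U \<in> delta_covers d 1 E" "(\<Sum>i. diam_pow d 0 (U i)) < 1"
      unfolding INF_less_iff by blast
    have "diam_pow d 0 (U i) < 1" for i
      using ennreal_le_suminf[of "\<lambda>i. diam_pow d 0 (U i)" i] U(2) by simp
    moreover have "diam_pow d 0 (U i) = 1" if "U i \<noteq> {}" for i
      using that by (simp add: diam_pow_def)
    ultimately have "U i = {}" for i by (metis less_irrefl)
    then have "E = {}" using U(1) by (auto simp: delta_covers_def)
    then show ?thesis using s True by (simp add: hnull_empty)
  next
    case False
    then show ?thesis
      using hnull_mono_exponent[OF hausdorff_measure_0_imp_hnull[OF s(2) _ nn]] s by simp
  qed
qed

section \<open>Dyadic content\<close>

text \<open>The half-open dyadic cube of side \<open>(1/2) ^ j\<close>, named by any of its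
  points.\<close>

definition dcell :: "nat \<Rightarrow> 'a::euclidean_space \<Rightarrow> 'a set" where
  "dcell j x = {y. \<forall>i\<in>Basis. \<lfloor>2 ^ j * (y \<bullet> i)\<rfloor> = \<lfloor>2 ^ j * (x \<bullet> i)\<rfloor>}"

lemma dcell_self [simp]: "x \<in> dcell j x"
  by (simp add: dcell_def)

lemma dcell_eq: "y \<in> dcell j x \<Longrightarrow> dcell j y = dcell j x"
  by (simp add: dcell_def)

lemma dcell_antimono:
  assumes "i \<le> j"
  shows "dcell j x \<subseteq> dcell i x"
proof -
  have "\<lfloor>2 ^ i * t\<rfloor> = \<lfloor>2 ^ j * t\<rfloor> div 2 ^ (j - i)" for t :: real
  proof -
    have "(2::real) ^ j = 2 ^ i * 2 ^ (j - i)" using assms by (simp flip: power_add)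
    then have "2 ^ i * t = (2 ^ j * t) / real_of_int (2 ^ (j - i))" by simp
    moreover have "\<lfloor>2 ^ j * t / real_of_int (2 ^ (j - i))\<rfloor> = \<lfloor>2 ^ j * t\<rfloor> div 2 ^ (j - i)"
      by (rule floor_divide_real_eq_div) simp
    ultimately show ?thesis by (simp only:)
  qed
  then show ?thesis by (auto simp: dcell_def)
qed

lemma dist_dcell_le:
  fixes x y :: "'a::euclidean_space"
  assumes "y \<in> dcell j x"
  shows "dist y x \<le> DIM('a) * (1/2) ^ j"
proof -
  have "\<bar>(y - x) \<bullet> i\<bar> \<le> (1/2) ^ j" if "i \<in> Basis" for i
  proof -
    have "\<lfloor>2 ^ j * (y \<bullet> i)\<rfloor> = \<lfloor>2 ^ j * (x \<bullet> i)\<rfloor>" using assms that by (simp add: dcell_def)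
    then have "\<bar>2 ^ j * (y \<bullet> i) - 2 ^ j * (x \<bullet> i)\<bar> \<le> 1" by linarith
    then have "2 ^ j * \<bar>(y - x) \<bullet> i\<bar> \<le> 1"
      by (simp add: inner_diff_left right_diff_distrib[symmetric] abs_mult)
    then show ?thesis by (simp add: field_simps power_divide)
  qed
  then have "(\<Sum>i\<in>Basis. \<bar>(y - x) \<bullet> i\<bar>) \<le> (\<Sum>i\<in>(Basis::'a set). (1/2) ^ j)"
    by (intro sum_mono)
  then show ?thesis using norm_le_l1[of "y - x"] by (simp add: dist_norm)
qed

text \<open>A cell is determined by the integer coordinates of its corner, so countability,
  finiteness and cardinality of families of cells reduce to products of index sets.\<close>

lemma dcells_subset_image_PiE:
  fixes B :: "'a::euclidean_space set"
  assumes "\<And>x i. x \<in> B \<Longrightarrow> i \<in> Basis \<Longrightarrow> \<lfloor>2 ^ j * (x \<bullet> i)\<rfloor> \<in> S i"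
  shows "dcell j ` B \<subseteq> (\<lambda>k. {y. \<forall>i\<in>Basis. \<lfloor>2 ^ j * (y \<bullet> i)\<rfloor> = k i}) ` PiE Basis S"
proof
  fix Q assume "Q \<in> dcell j ` B"
  then obtain x where x: "x \<in> B" "Q = dcell j x" by blast
  let ?k = "restrict (\<lambda>i. \<lfloor>2 ^ j * (x \<bullet> i)\<rfloor>) Basis"
  have "?k \<in> PiE Basis S" using assms x by auto
  moreover have "Q = {y. \<forall>i\<in>Basis. \<lfloor>2 ^ j * (y \<bullet> i)\<rfloor> = ?k i}" by (simp add: x dcell_def)
  ultimately show "Q \<in> (\<lambda>k. {y. \<forall>i\<in>Basis. \<lfloor>2 ^ j * (y \<bullet> i)\<rfloor> = k i}) ` PiE Basis S"
    by blast
qed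

lemma countable_dcells: "countable (range (dcell j :: 'a::euclidean_space \<Rightarrow> 'a set))"
  by (rule countable_subset[OF dcells_subset_image_PiE[of UNIV j "\<lambda>_. UNIV"]])
    (auto intro!: countable_image countable_PiE)

lemma finite_dcells_bounded:
  fixes B :: "'a::euclidean_space set"
  assumes "bounded B"
  shows "finite (dcell j ` B)"
proof -
  obtain R where R: "\<And>x. x \<in> B \<Longrightarrow> norm x \<le> R" using assms bounded_iff by blast
  have "\<lfloor>2 ^ j * (x \<bullet> i)\<rfloor> \<in> {\<lfloor>- (2 ^ j * R)\<rfloor> .. \<lfloor>2 ^ j * R\<rfloor>}" if "x \<in> B" "i \<in> Basis" for x i
  proof -
    have "\<bar>x \<bullet> i\<bar> \<le> R" using R[OF that(1)] Basis_le_norm[OF that(2), of x] by linarith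
    then have "2 ^ j * (x \<bullet> i) \<le> 2 ^ j * R" "2 ^ j * (- R) \<le> 2 ^ j * (x \<bullet> i)"
      by (intro mult_left_mono; simp add: abs_le_iff)+
    then show ?thesis by (auto intro: floor_mono)
  qed
  then show ?thesis
    by (intro finite_subset[OF dcells_subset_image_PiE[where S="\<lambda>_. {\<lfloor>- (2 ^ j * R)\<rfloor> .. \<lfloor>2 ^ j * R\<rfloor>}"]]
        finite_imageI finite_PiE) auto
qed

text \<open>Moving a point by at most one side length changes each integer coordinate by at most 1,
  which leaves 3 values per coordinate.\<close>

lemma card_dcells_cball:
  fixes z :: "'a::euclidean_space"
  shows "card (dcell j ` cball z ((1/2) ^ j)) \<le> 3 ^ DIM('a)"
proof -
  let ?S = "\<lambda>i. {\<lfloor>2 ^ j * (z \<bullet> i)\<rfloor> - 1 .. \<lfloor>2 ^ j * (z \<bullet> i)\<rfloor> + 1}"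
  have "\<lfloor>2 ^ j * (x \<bullet> i)\<rfloor> \<in> ?S i" if "x \<in> cball z ((1/2) ^ j)" "i \<in> Basis" for x i
  proof -
    have "\<bar>(x - z) \<bullet> i\<bar> \<le> (1/2) ^ j"
      using that Basis_le_norm[OF that(2), of "x - z"] by (simp add: dist_norm norm_minus_commute)
    then have "2 ^ j * \<bar>(x - z) \<bullet> i\<bar> \<le> 1" by (simp add: field_simps power_divide)
    then have "\<bar>2 ^ j * (x \<bullet> i) - 2 ^ j * (z \<bullet> i)\<bar> \<le> 1"
      by (simp add: inner_diff_left right_diff_distrib[symmetric] abs_mult)
    then show ?thesis by (simp; linarith)
  qed
  then have *: "dcell j ` cball z ((1/2) ^ j) \<subseteq>
      (\<lambda>k. {y. \<forall>i\<in>Basis. \<lfloor>2 ^ j * (y \<bullet> i)\<rfloor> = k i}) ` PiE Basis ?S"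
    by (rule dcells_subset_image_PiE)
  have fin: "finite (PiE Basis ?S)" by (intro finite_PiE) auto
  have "card (dcell j ` cball z ((1/2) ^ j)) \<le> card (PiE Basis ?S)"
    using card_mono[OF finite_imageI[OF fin] *] card_image_le[OF fin] by (rule order_trans)
  also have "\<dots> = 3 ^ DIM('a)" by (simp add: card_PiE)
  finally show ?thesis .
qed

text \<open>As a measure on pairs, this sum has additivity, subtraction and continuity along
  increasing unions without summability conditions.\<close>

definition dweight :: "real \<Rightarrow> (nat \<times> 'a set) set \<Rightarrow> ennreal" where
  "dweight p = emeasure (density (count_space UNIV) (\<lambda>(j, Q). ennreal (((1/2) ^ j) powr p)))"

text \<open>A family may also contain pairs \<open>(j, Q)\<close> in which \<open>Q\<close> is not a cell of level \<open>j\<close>; these only add weight.\<close>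

definition dcovers :: "(nat \<times> 'a::euclidean_space set) set \<Rightarrow> 'a set \<Rightarrow> bool" where
  "dcovers \<U> E \<longleftrightarrow> (\<forall>x\<in>E. \<exists>j. (j, dcell j x) \<in> \<U>)"

definition dcontent :: "real \<Rightarrow> 'a::euclidean_space set \<Rightarrow> ennreal" where
  "dcontent p E = (INF \<U> \<in> {\<U>. dcovers \<U> E}. dweight p \<U>)"

lemma dcontent_le: "dcovers \<U> E \<Longrightarrow> dcontent p E \<le> dweight p \<U>"
  unfolding dcontent_def by (rule INF_lower) simp

lemma dcontent_lessD: "dcontent p E < c \<Longrightarrow> \<exists>\<U>. dcovers \<U> E \<and> dweight p \<U> < c"
  unfolding dcontent_def INF_less_iff by (elim bexE) auto

lemma dcontent_mono: "E \<subseteq> F \<Longrightarrow> dcontent p E \<le> dcontent p F"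
  unfolding dcontent_def by (rule INF_superset_mono) (auto simp: dcovers_def)

lemma dweight_mono: "\<U> \<subseteq> \<V> \<Longrightarrow> dweight p \<U> \<le> dweight p \<V>"
  unfolding dweight_def by (rule emeasure_mono) simp_all

lemma dweight_Un_Int: "dweight p (\<U> \<union> \<V>) + dweight p (\<U> \<inter> \<V>) = dweight p \<U> + dweight p \<V>"
proof -
  let ?M = "density (count_space UNIV) (\<lambda>(j, Q). ennreal (((1/2) ^ j) powr p)) :: (nat \<times> 'a set) measure"
  have "\<U> \<in> sets ?M" "\<V> \<in> sets ?M" by simp_all
  from emeasure_Un_Int[OF this] show ?thesis unfolding dweight_def by (rule sym)
qed

lemma dweight_Un_le: "dweight p (\<U> \<union> \<V>) \<le> dweight p \<U> + dweight p \<V>"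
  unfolding dweight_def by (rule emeasure_subadditive) simp_all

lemma dweight_Diff: "\<V> \<subseteq> \<U> \<Longrightarrow> dweight p (\<U> - \<V>) + dweight p \<V> = dweight p \<U>"
  unfolding dweight_def by (subst plus_emeasure) (auto simp: Un_absorb2)

lemma dweight_finite:
  assumes "finite \<U>"
  shows "dweight p \<U> = ennreal (\<Sum>(j, Q)\<in>\<U>. ((1/2) ^ j) powr p)"
proof -
  have "dweight p \<U> = (\<Sum>c\<in>\<U>. case c of (j, Q) \<Rightarrow> ennreal (((1/2) ^ j) powr p))"
    unfolding dweight_def using assms
    by (simp add: emeasure_density nn_integral_count_space_indicator[symmetric] nn_integral_count_space_finite)
  also have "\<dots> = ennreal (\<Sum>(j, Q)\<in>\<U>. ((1/2) ^ j) powr p)"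
    by (subst sum_ennreal[symmetric]) (auto simp: case_prod_unfold)
  finally show ?thesis .
qed

lemma dcontent_0_imp_hnull:
  fixes E :: "'a::euclidean_space set"
  assumes "dcontent p E = 0" "0 < p"
  shows "hnull dist p E"
  unfolding hnull_def
proof (intro allI impI)
  fix \<epsilon> :: real assume "0 < \<epsilon>"
  define D where "D = real (DIM('a))"
  have D: "0 < D" by (simp add: D_def)
  have "dcontent p E < ennreal (\<epsilon> / D powr p)" using assms(1) \<open>0 < \<epsilon>\<close> D by simp
  then obtain \<U> where \<U>: "dcovers \<U> E" "dweight p \<U> < ennreal (\<epsilon> / D powr p)"
    using dcontent_lessD by blast
  \<comment> \<open>Discarding the pairs that are not cells keeps the cover and makes the family
    countable.\<close>
  define C where "C = (\<Union>j. Pair j ` range (dcell j :: 'a \<Rightarrow> 'a set))"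
  have "countable C" unfolding C_def by (intro countable_UN countable_image countable_dcells) auto
  define \<V> where "\<V> = \<U> \<inter> C"
  have "countable \<V>" using \<open>countable C\<close> by (auto simp: \<V>_def)
  \<comment> \<open>Each \<open>F i\<close> is empty or a singleton. Expressing the radii through
    these disjoint sets turns their series into countable additivity of
    \<open>dweight\<close>.\<close>
  define F where "F i = {c\<in>\<V>. to_nat_on \<V> c = i}" for i
  have F: "F i = {} \<or> (\<exists>c\<in>\<V>. F i = {c})" for i
  proof (cases "F i = {}")
    case False
    then obtain c where "c \<in> \<V>" "to_nat_on \<V> c = i" by (auto simp: F_def)
    then have "F i = {c}"
      using inj_on_to_nat_on[OF \<open>countable \<V>\<close>] by (auto simp: F_def dest: inj_onD)
    then show ?thesis using \<open>c \<in> \<V>\<close> by blast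
  qed simp
  define U where "U i = (\<Union>(j, Q)\<in>F i. Q)" for i
  define r where "r i = (if F i = {} then 0 else D * (1/2) ^ fst (the_elem (F i)))" for i
  have "E \<subseteq> (\<Union>i. U i)"
  proof
    fix x assume "x \<in> E"
    then obtain j where "(j, dcell j x) \<in> \<U>"
      using \<U>(1) unfolding dcovers_def by blast
    moreover have "(j, dcell j x) \<in> C" unfolding C_def by blast
    ultimately have "(j, dcell j x) \<in> \<V>" by (simp add: \<V>_def)
    then have "(j, dcell j x) \<in> F (to_nat_on \<V> (j, dcell j x))" by (simp add: F_def)
    then have "x \<in> U (to_nat_on \<V> (j, dcell j x))" unfolding U_def by (rule UN_I) simp
    then show "x \<in> (\<Union>i. U i)" by (rule UN_I[OF UNIV_I])
  qed
  moreover have "0 \<le> r i" for i using D by (simp add: r_def)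
  moreover have "dist x y \<le> r i" if xy: "x \<in> U i" "y \<in> U i" for x y i
  proof -
    obtain c where c: "c \<in> \<V>" "F i = {c}" using F[of i] xy by (auto simp: U_def)
    then obtain j z where "c = (j, dcell j z)" by (auto simp: \<V>_def C_def)
    then have "x \<in> dcell j z" "y \<in> dcell j z" "r i = D * (1/2) ^ j"
      using xy c by (auto simp: U_def r_def)
    then show ?thesis using dist_dcell_le[of x j y] dcell_eq[of y j z] by (simp add: D_def)
  qed
  moreover have "(\<Sum>i. ennreal (r i powr p)) \<le> ennreal \<epsilon>"
  proof -
    have "ennreal (r i powr p) = ennreal (D powr p) * dweight p (F i)" for i
    proof (cases "F i = {}")
      case True
      then show ?thesis using assms(2) by (simp add: r_def dweight_def)
    next
      case False
      then obtain c where c: "F i = {c}" using F[of i] by blast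
      then show ?thesis using D
        by (cases c) (simp add: r_def powr_mult ennreal_mult' dweight_finite)
    qed
    then have "(\<Sum>i. ennreal (r i powr p)) = ennreal (D powr p) * (\<Sum>i. dweight p (F i))"
      by simp
    also have "(\<Sum>i. dweight p (F i)) = dweight p (\<Union>i. F i)"
      unfolding dweight_def by (intro suminf_emeasure) (auto simp: disjoint_family_on_def F_def)
    also have "ennreal (D powr p) * dweight p (\<Union>i. F i) \<le> ennreal (D powr p) * dweight p \<U>"
      by (intro mult_left_mono dweight_mono) (auto simp: F_def \<V>_def)
    also have "\<dots> \<le> ennreal (D powr p) * ennreal (\<epsilon> / D powr p)"
      using \<U>(2) by (intro mult_left_mono) simp_all
    also have "\<dots> = ennreal \<epsilon>"
      using D by (simp add: ennreal_mult'[symmetric])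
    finally show ?thesis .
  qed
  ultimately have "hcover dist p E \<epsilon> U r" by (intro hcoverI)
  then show "\<exists>U r. hcover dist p E \<epsilon> U r" by blast
qed

section \<open>Strong subadditivity of the content and its continuity along increasing
  unions\<close>

definition dmaximal :: "(nat \<times> 'a::euclidean_space set) set \<Rightarrow> (nat \<times> 'a set) set" where
  "dmaximal \<G> = {(j, Q) \<in> \<G>. \<forall>i<j. \<forall>x\<in>Q. (i, dcell i x) \<notin> \<G>}"

text \<open>Smaller level means larger cell. The first level in \<G> at a point gives a maximal
  cell, since all points of a cell share the larger cells around it.\<close>

lemma dmaximal_least:
  assumes "(j, dcell j x) \<in> \<G>"
  obtains i where "i \<le> j" "(i, dcell i x) \<in> dmaximal \<G>"
proof
  let ?i = "LEAST i. (i, dcell i x) \<in> \<G>"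
  show "?i \<le> j" using assms by (rule Least_le)
  have "(?i, dcell ?i x) \<in> \<G>" using assms by (rule LeastI)
  moreover have "(k, dcell k y) \<notin> \<G>" if "k < ?i" "y \<in> dcell ?i x" for k y
  proof -
    have "y \<in> dcell k x" using dcell_antimono[of k ?i x] that by auto
    then show ?thesis using not_less_Least[OF that(1)] by (simp add: dcell_eq)
  qed
  ultimately show "(?i, dcell ?i x) \<in> dmaximal \<G>" unfolding dmaximal_def by blast
qed

lemma dcovers_dmaximal: "dcovers \<G> E \<Longrightarrow> dcovers (dmaximal \<G>) E"
  unfolding dcovers_def by (blast elim: dmaximal_least)

text \<open>Strong subadditivity: of two cells through a common point the smaller one is not maximal, so the
  discarded cells (counting common cells twice) still cover \<open>E\<close>.\<close>

lemma dweight_dmaximal_Un: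
  assumes "dcovers \<U> E" "dcovers \<V> E"
  shows "dweight p (dmaximal (\<U> \<union> \<V>)) + dcontent p E \<le> dweight p \<U> + dweight p \<V>"
proof -
  let ?G = "\<U> \<union> \<V>" let ?R = "(?G - dmaximal ?G) \<union> (\<U> \<inter> \<V>)"
  have "dcovers ?R E"
    unfolding dcovers_def
  proof
    fix x assume "x \<in> E"
    then obtain i where i: "(i, dcell i x) \<in> \<U>"
      using assms(1) unfolding dcovers_def by blast
    from \<open>x \<in> E\<close> obtain j where j: "(j, dcell j x) \<in> \<V>"
      using assms(2) unfolding dcovers_def by blast
    note ij = i j
    consider "i = j" | "i < j" | "j < i" by linarith
    then show "\<exists>k. (k, dcell k x) \<in> ?R"
    proof cases
      case 1
      then show ?thesis using ij by auto
    next
      case 2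
      then have "(j, dcell j x) \<notin> dmaximal ?G"
        using ij dcell_self[of x j] unfolding dmaximal_def by blast
      then show ?thesis using ij by (intro exI[of _ j]) simp
    next
      case 3
      then have "(i, dcell i x) \<notin> dmaximal ?G"
        using ij dcell_self[of x i] unfolding dmaximal_def by blast
      then show ?thesis using ij by (intro exI[of _ i]) simp
    qed
  qed
  then have "dweight p (dmaximal ?G) + dcontent p E \<le> dweight p (dmaximal ?G) + dweight p ?R"
    by (intro add_left_mono dcontent_le)
  also have "\<dots> \<le> dweight p (dmaximal ?G) + (dweight p (?G - dmaximal ?G) + dweight p (\<U> \<inter> \<V>))"
    by (intro add_left_mono dweight_Un_le)
  also have "\<dots> = dweight p ?G + dweight p (\<U> \<inter> \<V>)"
    using dweight_Diff[of "dmaximal ?G" ?G p] by (auto simp: dmaximal_def ac_simps)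
  also have "\<dots> = dweight p \<U> + dweight p \<V>" by (rule dweight_Un_Int)
  finally show ?thesis .
qed

text \<open>Near-optimal covers of the \<open>E m\<close> are merged successively. Strong subadditivity keeps them
  near-optimal, and the level of the cell through a given point can only decrease, hence stabilises;
  so the cells that are eventually present in all merged covers cover the union.\<close>

lemma dcontent_UN_incseq_le:
  fixes E :: "nat \<Rightarrow> 'a::euclidean_space set"
  assumes "incseq E" and le: "\<And>m. dcontent p (E m) \<le> ennreal \<eta>"
  shows "dcontent p (\<Union>m. E m) \<le> ennreal \<eta>"
proof (rule ennreal_le_epsilon)
  fix \<epsilon> :: real assume "0 < \<epsilon>"
  have fin: "dcontent p (E m) < \<infinity>" for m
    using le[of m] by (simp add: order_le_less_trans[OF _ ennreal_less_top])
  have "\<exists>\<U>. dcovers \<U> (E m) \<and> dweight p \<U> < dcontent p (E m) + ennreal (\<epsilon> * (1/2) ^ Suc m)" for m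
    using fin[of m] \<open>0 < \<epsilon>\<close> by (intro dcontent_lessD) (simp add: ennreal_zero_less_mult_iff)
  then obtain U where U: "\<And>m. dcovers (U m) (E m)"
    "\<And>m. dweight p (U m) < dcontent p (E m) + ennreal (\<epsilon> * (1/2) ^ Suc m)" by metis
  define V where "V = rec_nat (U 0) (\<lambda>m v. dmaximal (v \<union> U (Suc m)))"
  have V0: "V 0 = U 0" and VS: "V (Suc m) = dmaximal (V m \<union> U (Suc m))" for m
    by (simp_all add: V_def)
  have Vcov: "dcovers (V m) (E m)" for m
  proof (cases m)
    case (Suc k)
    have "dcovers (V k \<union> U (Suc k)) (E (Suc k))" using U(1)[of "Suc k"] by (auto simp: dcovers_def)
    then show ?thesis unfolding Suc VS by (rule dcovers_dmaximal)
  qed (simp add: V0 U)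
  \<comment> \<open>Strong subadditivity relative to \<open>E m\<close> adds the excesses of the two
    covers, so the errors sum to a geometric series. The common term \<open>dcontent p (E m)\<close>
    can be cancelled because it is finite.\<close>
  have Vw: "dweight p (V m) \<le> dcontent p (E m) + ennreal (\<epsilon> * (1 - (1/2) ^ Suc m))" for m
  proof (induction m)
    case 0
    then show ?case using U(2)[of 0] by (simp add: V0)
  next
    case (Suc m)
    have "dcovers (U (Suc m)) (E m)"
      using U(1)[of "Suc m"] incseqD[OF assms(1), of m "Suc m"] by (auto simp: dcovers_def)
    then have "dcontent p (E m) + dweight p (V (Suc m)) \<le> dweight p (V m) + dweight p (U (Suc m))"
      using dweight_dmaximal_Un[OF Vcov[of m], of "U (Suc m)" p] by (simp add: VS add.commute)
    also have "\<dots> \<le> (dcontent p (E m) + ennreal (\<epsilon> * (1 - (1/2) ^ Suc m))) +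
        (dcontent p (E (Suc m)) + ennreal (\<epsilon> * (1/2) ^ Suc (Suc m)))"
      using Suc.IH U(2)[of "Suc m"] by (intro add_mono) auto
    also have "\<dots> = dcontent p (E m) + (dcontent p (E (Suc m)) +
        (ennreal (\<epsilon> * (1 - (1/2) ^ Suc m)) + ennreal (\<epsilon> * (1/2) ^ Suc (Suc m))))"
      by (simp add: ac_simps)
    also have "ennreal (\<epsilon> * (1 - (1/2) ^ Suc m)) + ennreal (\<epsilon> * (1/2) ^ Suc (Suc m)) =
        ennreal (\<epsilon> * (1 - (1/2) ^ Suc m) + \<epsilon> * (1/2) ^ Suc (Suc m))"
      using \<open>0 < \<epsilon>\<close> power_le_one[of "1/2::real" "Suc m"]
      by (intro ennreal_plus[symmetric] mult_nonneg_nonneg) simp_all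
    also have "\<epsilon> * (1 - (1/2) ^ Suc m) + \<epsilon> * (1/2) ^ Suc (Suc m) = \<epsilon> * (1 - (1/2) ^ Suc (Suc m))"
      by (simp add: algebra_simps)
    finally show ?case using fin[of m] by (auto simp: ennreal_add_left_cancel_le less_top)
  qed
  have Vnest: "\<exists>i\<le>j. (i, dcell i x) \<in> V (Suc m)" if "(j, dcell j x) \<in> V m" for j x m
  proof -
    have "(j, dcell j x) \<in> V m \<union> U (Suc m)" using that by simp
    then obtain i where "i \<le> j" "(i, dcell i x) \<in> V (Suc m)" unfolding VS by (rule dmaximal_least)
    then show ?thesis by blast
  qed
  \<comment> \<open>These intersections increase with \<open>m\<close>, and each weighs no more than
    the cover \<open>V m\<close>.\<close>
  define I where "I m = (\<Inter>l\<in>{m..}. V l)" for m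
  have "dcovers (\<Union>m. I m) (\<Union>m. E m)"
    unfolding dcovers_def
  proof
    fix x assume "x \<in> (\<Union>m. E m)"
    then obtain m where m: "x \<in> E m" by blast
    have ex: "\<exists>j. (j, dcell j x) \<in> V (m + l)" for l
      using Vcov[of "m + l"] m incseqD[OF assms(1), of m "m + l"] by (auto simp: dcovers_def)
    define lev where "lev l = (LEAST j. (j, dcell j x) \<in> V (m + l))" for l
    have lev: "(lev l, dcell (lev l) x) \<in> V (m + l)" for l
      unfolding lev_def using ex[of l] by (rule LeastI_ex)
    have "lev (Suc l) \<le> lev l" for l
    proof -
      obtain i where "i \<le> lev l" "(i, dcell i x) \<in> V (Suc (m + l))" using Vnest[OF lev] by blast
      then have "lev (Suc l) \<le> i" unfolding lev_def by (intro Least_le) simp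
      with \<open>i \<le> lev l\<close> show ?thesis by simp
    qed
    then have dec: "lev l' \<le> lev l" if "l \<le> l'" for l l'
      using lift_Suc_antimono_le[of lev l l'] that by blast
    obtain L where "\<And>l. lev L \<le> lev l"
      using ex_has_least_nat[of "\<lambda>_. True" 0 lev] by auto
    then have "lev (L + l) = lev L" for l
      using dec[of L "L + l"] by (simp add: le_antisym)
    then have "(lev L, dcell (lev L) x) \<in> V (m + (L + l))" for l
      using lev[of "L + l"] by simp
    then have "(lev L, dcell (lev L) x) \<in> V k" if "m + L \<le> k" for k
      using that by (metis nat_le_iff_add add.assoc)
    then have "(lev L, dcell (lev L) x) \<in> I (m + L)"
      by (simp add: I_def)
    then show "\<exists>j. (j, dcell j x) \<in> (\<Union>m. I m)" by (intro exI UN_I[OF UNIV_I])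
  qed
  then have "dcontent p (\<Union>m. E m) \<le> dweight p (\<Union>m. I m)" by (rule dcontent_le)
  also have "\<dots> = (SUP m. dweight p (I m))"
    unfolding dweight_def
    by (rule SUP_emeasure_incseq[symmetric]) (auto simp: incseq_def I_def)
  also have "\<dots> \<le> ennreal \<eta> + ennreal \<epsilon>"
  proof (rule SUP_least)
    fix m
    have "dweight p (I m) \<le> dweight p (V m)" by (intro dweight_mono) (auto simp: I_def)
    also note Vw[of m]
    also have "dcontent p (E m) + ennreal (\<epsilon> * (1 - (1/2) ^ Suc m)) \<le> ennreal \<eta> + ennreal \<epsilon>"
      using \<open>0 < \<epsilon>\<close> by (intro add_mono le ennreal_leI) (simp add: mult_left_le)
    finally show "dweight p (I m) \<le> ennreal \<eta> + ennreal \<epsilon>" .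
  qed
  finally show "dcontent p (\<Union>m. E m) \<le> ennreal \<eta> + ennreal \<epsilon>" .
qed

section \<open>Compact subsets of positive content\<close>

text \<open>Projections of closed sets from the Baire space: closure under countable intersections is immediate,
  and the first coordinates of the sequences can be bounded successively in the capacitability argument.\<close>

definition suslin :: "'a::euclidean_space set \<Rightarrow> bool" where
  "suslin A \<longleftrightarrow> (\<exists>F :: ((nat \<Rightarrow> nat) \<times> 'a) set. closed F \<and> A = snd ` F)"

lemma suslin_closed: "closed A \<Longrightarrow> suslin A"
  unfolding suslin_def by (intro exI[of _ "UNIV \<times> A"]) (auto intro: closed_Times)

lemma continuous_fst_coordinate: "continuous_on UNIV (\<lambda>z :: (nat \<Rightarrow> nat) \<times> 'a::topological_space. fst z n)"
  by (rule continuous_on_product_then_coordinatewise[OF continuous_on_fst[OF continuous_on_id]])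

lemma closed_reindex_vimage:
  fixes G :: "((nat \<Rightarrow> nat) \<times> 'a::topological_space) set" and h :: "nat \<Rightarrow> nat"
  assumes "closed G"
  shows "closed {z. ((\<lambda>j. fst z (h j)), snd z) \<in> G}"
proof -
  have "continuous_on UNIV (\<lambda>z :: (nat \<Rightarrow> nat) \<times> 'a. ((\<lambda>j. fst z (h j)), snd z))"
    by (intro continuous_on_Pair continuous_on_coordinatewise_then_product
        continuous_fst_coordinate continuous_on_snd continuous_on_id)
  from closed_vimage[OF assms this] show ?thesis by (simp add: vimage_def)
qed

lemma suslin_UN:
  fixes A :: "nat \<Rightarrow> 'a::euclidean_space set"
  assumes "\<And>n. suslin (A n)"
  shows "suslin (\<Union>n. A n)"
proof -
  have "\<forall>n. \<exists>F :: ((nat \<Rightarrow> nat) \<times> 'a) set. closed F \<and> A n = snd ` F"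
    by (intro allI assms[unfolded suslin_def])
  then obtain G :: "nat \<Rightarrow> ((nat \<Rightarrow> nat) \<times> 'a) set"
    where G: "\<And>n. closed (G n)" "\<And>n. A n = snd ` G n" by metis
  \<comment> \<open>The first coordinate selects the index \<open>n\<close>, and the shifted
    sequence is the witness for \<open>A n\<close>.\<close>
  define F where "F = {z. ((\<lambda>j. fst z (Suc j)), snd z) \<in> G (fst z 0)}"
  \<comment> \<open>Closedness of a set whose condition varies with the point: one implication per
    \<open>n\<close>, with a premise that is clopen because \<open>nat\<close> is discrete.\<close>
  have "F = (\<Inter>n. {z. fst z 0 \<in> - {n}} \<union> {z. ((\<lambda>j. fst z (Suc j)), snd z) \<in> G n})"
    by (auto simp: F_def)
  moreover have "closed ({z :: (nat \<Rightarrow> nat) \<times> 'a. fst z 0 \<in> - {n}})" for n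
  proof -
    have "closed (- {n})" by (simp add: closed_def open_discrete)
    from closed_vimage[OF this continuous_fst_coordinate[of 0]] show ?thesis
      by (simp only: vimage_def)
  qed
  ultimately have "closed F"
    using G(1) by (simp only:) (intro closed_INT ballI closed_Un closed_reindex_vimage)
  moreover have "(\<Union>n. A n) = snd ` F"
  proof
    show "(\<Union>n. A n) \<subseteq> snd ` F"
    proof
      fix x assume "x \<in> (\<Union>n. A n)"
      then obtain n \<sigma> where "(\<sigma>, x) \<in> G n" using G(2) by auto
      then have "(case_nat n \<sigma>, x) \<in> F" by (simp add: F_def)
      then show "x \<in> snd ` F" by force
    qed
    show "snd ` F \<subseteq> (\<Union>n. A n)"
    proof
      fix x assume "x \<in> snd ` F"
      then obtain \<sigma> where "((\<lambda>j. \<sigma> (Suc j)), x) \<in> G (\<sigma> 0)" by (auto simp: F_def)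
      then have "x \<in> A (\<sigma> 0)" unfolding G(2) by force
      then show "x \<in> (\<Union>n. A n)" by (rule UN_I[OF UNIV_I])
    qed
  qed
  ultimately show ?thesis unfolding suslin_def by blast
qed

lemma suslin_INT:
  fixes A :: "nat \<Rightarrow> 'a::euclidean_space set"
  assumes "\<And>n. suslin (A n)"
  shows "suslin (\<Inter>n. A n)"
proof -
  have "\<forall>n. \<exists>F :: ((nat \<Rightarrow> nat) \<times> 'a) set. closed F \<and> A n = snd ` F"
    by (intro allI assms[unfolded suslin_def])
  then obtain G :: "nat \<Rightarrow> ((nat \<Rightarrow> nat) \<times> 'a) set"
    where G: "\<And>n. closed (G n)" "\<And>n. A n = snd ` G n" by metis
  \<comment> \<open>One sequence encodes countably many through the pairing function, which supplies
    all the witnesses simultaneously.\<close>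
  define F where "F = (\<Inter>n. {z. ((\<lambda>j. fst z (prod_encode (n, j))), snd z) \<in> G n})"
  have "closed F"
    unfolding F_def using G(1) by (intro closed_INT ballI closed_reindex_vimage)
  moreover have "(\<Inter>n. A n) = snd ` F"
  proof
    show "(\<Inter>n. A n) \<subseteq> snd ` F"
    proof
      fix x assume x: "x \<in> (\<Inter>n. A n)"
      have "\<forall>n. \<exists>\<sigma>. (\<sigma>, x) \<in> G n"
      proof
        fix n
        have "x \<in> snd ` G n" using x unfolding G(2)[symmetric] by blast
        then show "\<exists>\<sigma>. (\<sigma>, x) \<in> G n" by force
      qed
      then obtain \<sigma> where \<sigma>: "\<And>n. (\<sigma> n, x) \<in> G n" by metis
      have "((\<lambda>m. case_prod \<sigma> (prod_decode m)), x) \<in> F" using \<sigma> by (simp add: F_def)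
      then show "x \<in> snd ` F" by force
    qed
    show "snd ` F \<subseteq> (\<Inter>n. A n)"
    proof
      fix x assume "x \<in> snd ` F"
      then obtain \<sigma> where \<sigma>: "((\<lambda>j. \<sigma> (prod_encode (n, j))), x) \<in> G n" for n
        by (auto simp: F_def)
      have "x \<in> A n" for n unfolding G(2) using \<sigma>[of n] by force
      then show "x \<in> (\<Inter>n. A n)" by blast
    qed
  qed
  ultimately show ?thesis unfolding suslin_def by blast
qed

lemma suslin_borel:
  fixes A :: "'a::euclidean_space set"
  assumes "A \<in> sets borel"
  shows "suslin A"
proof -
  have "A \<in> sigma_sets UNIV {S. open S}"
    using assms by (simp add: borel_def)
  \<comment> \<open>Suslin sets are not closed under complements in general, so the induction
    carries the complement along.\<close>
  then have "suslin A \<and> suslin (- A)"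
  proof (induction rule: sigma_sets.induct)
    case (Basic S)
    then have "open S" by simp
    then obtain C :: "nat \<Rightarrow> 'a set" where "\<And>n. compact (C n)" "(\<Union>n. C n) = S"
      by (rule open_Union_compact_subsets) blast
    then have "suslin S" using suslin_UN[of C] by (simp add: compact_imp_closed suslin_closed)
    then show ?case using \<open>open S\<close> by (simp add: suslin_closed closed_Compl)
  next
    case Empty
    then show ?case by (simp add: suslin_closed)
  next
    case (Compl S)
    then show ?case by (simp add: Compl_eq_Diff_UNIV double_diff)
  next
    case (Union S)
    then show ?case using suslin_UN[of S] suslin_INT[of "\<lambda>n. - S n"] by simp
  qed
  then show ?thesis ..
qed

section \<open>Capacitability\<close>

text \<open>The content is bounded below on neighbourhoods of \<open>K\<close> only, because half-open cells do not
  behave well under decreasing limits of compact sets. Neighbourhoods suffice later on, since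
  an open cover of a compact set also covers a neighbourhood of it.\<close>

definition fat :: "real \<Rightarrow> 'a::euclidean_space set \<Rightarrow> bool" where
  "fat p K \<longleftrightarrow> (\<exists>\<eta>>0. \<forall>U. open U \<longrightarrow> K \<subseteq> U \<longrightarrow> ennreal \<eta> \<le> dcontent p U)"

lemma compact_bounded_sequences: "compact {\<sigma> :: nat \<Rightarrow> nat. \<forall>i. \<sigma> i \<le> m i}"
proof -
  have "compactin (product_topology (\<lambda>i. euclidean) UNIV) (PiE UNIV (\<lambda>i. {..m i}))"
    by (simp add: compactin_PiE finite_imp_compact)
  moreover have "PiE UNIV (\<lambda>i. {..m i}) = {\<sigma>. \<forall>i. \<sigma> i \<le> m i}" by (auto simp: PiE_def Pi_def)
  ultimately show ?thesis by (simp add: euclidean_product_topology)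
qed

lemma tendsto_fun_iff:
  fixes f :: "'b \<Rightarrow> 'c \<Rightarrow> 'd::topological_space"
  shows "(f \<longlongrightarrow> l) F \<longleftrightarrow> (\<forall>i. ((\<lambda>k. f k i) \<longlongrightarrow> l i) F)"
  using limitin_componentwise[of "\<lambda>_. euclidean" UNIV f l F]
  by (simp add: euclidean_product_topology limitin_canonical_iff)

text \<open>Choquet's argument. Continuity along increasing unions lets one coordinate after another
  be bounded with content still above \<open>\<eta>\<close>. Sequences with all coordinates bounded
  form a compact set, and every neighbourhood of its projection already contains some
  \<open>E k m\<close>, where only \<open>k\<close> coordinates are bounded.\<close>

lemma fat_compact_subset:
  fixes A :: "'a::euclidean_space set"
  assumes "A \<in> sets borel" "bounded A" "dcontent p A \<noteq> 0"
  obtains K where "compact K" "K \<subseteq> A" "fat p K"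
proof -
  obtain F :: "((nat \<Rightarrow> nat) \<times> 'a) set" where F: "closed F" "A = snd ` F"
    using suslin_borel[OF assms(1)] unfolding suslin_def by blast
  have "0 < dcontent p A" using assms(3) by (simp add: zero_less_iff_neq_zero)
  then obtain \<eta>' where \<eta>': "0 < \<eta>'" "\<eta>' < dcontent p A" using dense by blast
  define \<eta> where "\<eta> = enn2real \<eta>'"
  have "\<eta>' < \<infinity>" using \<eta>'(2) by (rule less_le_trans) simp
  then have \<eta>: "0 < \<eta>" "ennreal \<eta> < dcontent p A"
    using \<eta>' by (simp_all add: \<eta>_def enn2real_positive_iff)
  define E where "E k m = {x. \<exists>\<sigma>. (\<sigma>, x) \<in> F \<and> (\<forall>i<k. \<sigma> i \<le> m i)}" for k :: nat and m :: "nat \<Rightarrow> nat"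
  have step: "\<exists>r. ennreal \<eta> < dcontent p (E (Suc k) (m(k := r)))"
    if "ennreal \<eta> < dcontent p (E k m)" for k m
  proof (rule ccontr)
    assume "\<not> ?thesis"
    then have "\<And>r. dcontent p (E (Suc k) (m(k := r))) \<le> ennreal \<eta>" by (auto simp: not_less)
    moreover have "incseq (\<lambda>r. E (Suc k) (m(k := r)))"
      by (auto simp: incseq_def E_def less_Suc_eq) (metis order_trans)
    ultimately have "dcontent p (\<Union>r. E (Suc k) (m(k := r))) \<le> ennreal \<eta>"
      by (intro dcontent_UN_incseq_le[of "\<lambda>r. E (Suc k) (m(k := r))"])
    moreover have "E k m \<subseteq> (\<Union>r. E (Suc k) (m(k := r)))"
    proof
      fix x assume "x \<in> E k m"
      then obtain \<sigma> where "(\<sigma>, x) \<in> F" "\<forall>i<k. \<sigma> i \<le> m i" by (auto simp: E_def)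
      then have "x \<in> E (Suc k) (m(k := \<sigma> k))" by (auto simp: E_def less_Suc_eq)
      then show "x \<in> (\<Union>r. E (Suc k) (m(k := r)))" by (rule UN_I[OF UNIV_I])
    qed
    ultimately have "dcontent p (E k m) \<le> ennreal \<eta>"
      using dcontent_mono order_trans by blast
    then show False using that by simp
  qed
  define mm where "mm = rec_nat (\<lambda>_. 0) (\<lambda>k m. m(k := (SOME r. ennreal \<eta> < dcontent p (E (Suc k) (m(k := r))))))"
  have mm0: "mm 0 = (\<lambda>_. 0)" and
    mmS: "mm (Suc k) = (mm k)(k := (SOME r. ennreal \<eta> < dcontent p (E (Suc k) ((mm k)(k := r)))))" for k
    by (simp_all add: mm_def)
  have mm: "ennreal \<eta> < dcontent p (E k (mm k))" for k
  proof (induction k)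
    case 0
    have "E 0 (mm 0) = A" unfolding F(2) E_def by force
    then show ?case using \<eta>(2) by simp
  next
    case (Suc k)
    then show ?case unfolding mmS by (rule someI_ex[OF step])
  qed
  \<comment> \<open>Coordinate \<open>i\<close> is fixed at stage \<open>Suc i\<close> and never
    changed afterwards.\<close>
  define m where "m i = mm (Suc i) i" for i
  have stable: "mm k i = m i" if "i < k" for i k
    using that by (induction k) (auto simp: less_Suc_eq m_def mmS)
  have Em: "ennreal \<eta> < dcontent p (E k m)" for k
  proof -
    have "E k (mm k) = E k m" unfolding E_def using stable by (intro Collect_cong) auto
    then show ?thesis using mm[of k] by simp
  qed
  define P where "P = {\<sigma> :: nat \<Rightarrow> nat. \<forall>i. \<sigma> i \<le> m i} \<times> closure A"
  have P: "compact P"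
    unfolding P_def using assms(2) by (intro compact_Times compact_bounded_sequences) (simp add: compact_closure)
  show thesis
  proof
    let ?K = "snd ` (F \<inter> P)"
    show "compact ?K"
      using F(1) P by (intro compact_continuous_image continuous_on_snd continuous_on_id closed_Int_compact)
    show "?K \<subseteq> A" using F(2) by auto
    have "\<exists>k. E k m \<subseteq> U" if U: "open U" "?K \<subseteq> U" for U
    proof (rule ccontr)
      assume "\<nexists>k. E k m \<subseteq> U"
      then have "\<forall>k. \<exists>x. x \<in> E k m \<and> x \<notin> U" by blast
      then obtain x where x: "\<And>k. x k \<in> E k m" "\<And>k. x k \<notin> U" by metis
      have "\<forall>k. \<exists>\<sigma>. (\<sigma>, x k) \<in> F \<and> (\<forall>i<k. \<sigma> i \<le> m i)" using x(1) by (simp add: E_def)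
      then obtain \<sigma> where \<sigma>: "\<And>k. (\<sigma> k, x k) \<in> F" "\<And>k i. i < k \<Longrightarrow> \<sigma> k i \<le> m i" by metis
      \<comment> \<open>Truncation puts the sequences into the compact set without affecting limits:
        any fixed coordinate is eventually unchanged.\<close>
      define \<tau> where "\<tau> k i = (if i < k then \<sigma> k i else 0)" for k i
      have "x k \<in> A" for k unfolding F(2) using \<sigma>(1)[of k] by force
      then have "(\<tau> k, x k) \<in> P" for k
        using \<sigma>(2) closure_subset[of A] unfolding P_def \<tau>_def by auto
      then obtain l r where l: "l \<in> P" "strict_mono r" "((\<lambda>k. (\<tau> k, x k)) \<circ> r) \<longlonglongrightarrow> l"
        using seq_compactE[OF compact_imp_seq_compact[OF P], of "\<lambda>k. (\<tau> k, x k)"] by blast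
      obtain \<tau>' x' where l_eq: "l = (\<tau>', x')" by (cases l)
      have "(\<lambda>k. \<tau> (r k)) \<longlonglongrightarrow> \<tau>'" and x': "(\<lambda>k. x (r k)) \<longlonglongrightarrow> x'"
        using tendsto_fst[OF l(3)] tendsto_snd[OF l(3)] by (simp_all add: l_eq o_def)
      have "(\<lambda>k. \<sigma> (r k) i) \<longlonglongrightarrow> \<tau>' i" for i
      proof -
        have "(\<lambda>k. \<tau> (r k) i) \<longlonglongrightarrow> \<tau>' i"
          using \<open>(\<lambda>k. \<tau> (r k)) \<longlonglongrightarrow> \<tau>'\<close> by (simp add: tendsto_fun_iff)
        moreover have "\<forall>\<^sub>F k in sequentially. \<tau> (r k) i = \<sigma> (r k) i"
          using eventually_gt_at_top[of i]
          by eventually_elim (use seq_suble[OF l(2)] in \<open>simp add: \<tau>_def order_less_le_trans\<close>)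
        ultimately show ?thesis by (rule Lim_transform_eventually)
      qed
      then have "(\<lambda>k. \<sigma> (r k)) \<longlonglongrightarrow> \<tau>'" by (simp add: tendsto_fun_iff)
      then have "(\<lambda>k. (\<sigma> (r k), x (r k))) \<longlonglongrightarrow> (\<tau>', x')" using x' by (rule tendsto_Pair)
      from closed_sequentially[OF F(1) \<sigma>(1) this] have "(\<tau>', x') \<in> F" .
      then have "x' \<in> U" using U(2) l(1) l_eq by force
      moreover have "x' \<in> - U"
        by (rule closed_sequentially[OF _ _ x']) (use U(1) x(2) in auto)
      ultimately show False by simp
    qed
    then have "\<forall>U. open U \<longrightarrow> ?K \<subseteq> U \<longrightarrow> ennreal \<eta> \<le> dcontent p U"
      using Em dcontent_mono by (meson less_imp_le order_trans)
    then show "fat p ?K" unfolding fat_def using \<eta>(1) by blast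
  qed
qed

section \<open>Finite Frostman weights\<close>

text \<open>Start with equal weights on one point per cell of level \<open>m\<close> and go down through the levels, scaling
  down the weights in every overloaded cell. In the end every point lies in a saturated cell, and
  the largest saturated cells form a disjoint cover.\<close>

lemma dyadic_frostman:
  fixes E :: "'a::euclidean_space set"
  assumes "bounded E"
  shows "\<exists>S f. finite S \<and> S \<subseteq> E \<and> (\<forall>y. 0 \<le> f y) \<and>
    (\<forall>j x. j \<le> m \<longrightarrow> sum f (S \<inter> dcell j x) \<le> ((1/2) ^ j) powr p) \<and>
    dcontent p E \<le> ennreal (sum f S)"
proof -
  define w where "w j = ((1/2::real) ^ j) powr p" for j
  have w: "0 < w j" for j by (simp add: w_def)
  from iffD1[OF subset_image_inj[of "dcell m ` E" "dcell m" E] subset_refl]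
  obtain S where "S \<subseteq> E \<and> inj_on (dcell m) S \<and> dcell m ` E = dcell m ` S" by (rule exE)
  then have S: "S \<subseteq> E" "inj_on (dcell m) S" "dcell m ` E = dcell m ` S" by simp_all
  have fin: "finite S"
    using finite_imageD[OF _ S(2)] finite_dcells_bounded[OF assms, of m] S(3) by simp
  define sat where "sat f i x \<longleftrightarrow> i \<le> m \<and> sum f (S \<inter> dcell i x) = w i" for f i x
  \<comment> \<open>The induction runs from level \<open>m\<close> down to 0. At level
    \<open>j\<close> the mass bounds hold for levels from \<open>j\<close> to \<open>m\<close>, and
    each point lies in a saturated cell of such a level.\<close>
  have "\<exists>f. (\<forall>y. 0 \<le> f y) \<and> (\<forall>i x. 0 \<le> i \<longrightarrow> i \<le> m \<longrightarrow> sum f (S \<inter> dcell i x) \<le> w i) \<and>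
      (\<forall>x\<in>S. \<exists>i\<ge>0. sat f i x)"
  proof (rule inc_induct[where i=0 and j=m])
    have single: "S \<inter> dcell m x = {x}" if "x \<in> S" for x
      using S(2) that by (auto dest: dcell_eq inj_onD)
    have "sum (\<lambda>_. w m) (S \<inter> dcell m x) \<le> w m" for x
    proof (cases "S \<inter> dcell m x = {}")
      case False
      then obtain y where "y \<in> S" "y \<in> dcell m x" by blast
      then have "S \<inter> dcell m x = {y}" using single[of y] dcell_eq by metis
      then show ?thesis by simp
    next
      case True
      then show ?thesis using w[of m] by simp
    qed
    then show "\<exists>f. (\<forall>y. 0 \<le> f y) \<and> (\<forall>i x. m \<le> i \<longrightarrow> i \<le> m \<longrightarrow> sum f (S \<inter> dcell i x) \<le> w i) \<and>
      (\<forall>x\<in>S. \<exists>i\<ge>m. sat f i x)"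
      using w[of m] single by (intro exI[of _ "\<lambda>_. w m"]) (auto simp: sat_def)
  next
    fix j assume "j < m"
    assume "\<exists>f. (\<forall>y. 0 \<le> f y) \<and> (\<forall>i x. Suc j \<le> i \<longrightarrow> i \<le> m \<longrightarrow> sum f (S \<inter> dcell i x) \<le> w i) \<and>
      (\<forall>x\<in>S. \<exists>i\<ge>Suc j. sat f i x)"
    then obtain f where f: "\<And>y. 0 \<le> f y"
      "\<And>i x. Suc j \<le> i \<Longrightarrow> i \<le> m \<Longrightarrow> sum f (S \<inter> dcell i x) \<le> w i"
      "\<And>x. x \<in> S \<Longrightarrow> \<exists>i\<ge>Suc j. sat f i x" by blast
    define F where "F x = sum f (S \<inter> dcell j x)" for x
    \<comment> \<open>The factor is constant on cells of level \<open>j\<close> and at most 1, so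
      finer bounds survive. If it is 1, finer saturated cells stay saturated; otherwise the cell of
      level \<open>j\<close> becomes saturated.\<close>
    define c where "c x = (if F x \<le> w j then 1 else w j / F x)" for x
    have F0: "0 \<le> F x" for x using f(1) by (simp add: F_def sum_nonneg)
    have c: "0 \<le> c x" "c x \<le> 1" for x using F0[of x] w[of j] by (auto simp: c_def)
    define f' where "f' y = c y * f y" for y
    have scale: "sum f' (S \<inter> dcell i x) = c x * sum f (S \<inter> dcell i x)" if "j \<le> i" for i x
    proof -
      have "f' y = c x * f y" if "y \<in> dcell i x" for y
      proof -
        have "y \<in> dcell j x" using that dcell_antimono[OF \<open>j \<le> i\<close>] by blast
        then show ?thesis by (simp add: f'_def c_def F_def dcell_eq)
      qed
      then show ?thesis unfolding sum_distrib_left by (intro sum.cong) auto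
    qed
    have top: "sum f' (S \<inter> dcell j x) = min (F x) (w j)" for x
      using scale[of j x] w[of j] by (auto simp: c_def F_def min_def)
    have "\<forall>y. 0 \<le> f' y" using c f(1) by (simp add: f'_def)
    moreover have "sum f' (S \<inter> dcell i x) \<le> w i" if "j \<le> i" "i \<le> m" for i x
    proof (cases "i = j")
      case True
      then show ?thesis using top[of x] by simp
    next
      case False
      then have "sum f (S \<inter> dcell i x) \<le> w i" using f(2) that by simp
      moreover have "0 \<le> sum f (S \<inter> dcell i x)" using f(1) by (simp add: sum_nonneg)
      ultimately show ?thesis unfolding scale[OF that(1)] using c[of x]
        by (meson mult_left_le_one_le order_trans)
    qed
    moreover have "\<exists>i\<ge>j. sat f' i x" if x: "x \<in> S" for x
    proof (cases "F x \<le> w j")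
      case True
      obtain i where "Suc j \<le> i" "sat f i x" using f(3)[OF x] by blast
      then have "j \<le> i" "sat f' i x" using True scale[of i x] by (auto simp: sat_def c_def)
      then show ?thesis by blast
    next
      case False
      then have "sat f' j x" using top[of x] \<open>j < m\<close> by (simp add: sat_def)
      then show ?thesis by blast
    qed
    ultimately show "\<exists>f. (\<forall>y. 0 \<le> f y) \<and> (\<forall>i x. j \<le> i \<longrightarrow> i \<le> m \<longrightarrow> sum f (S \<inter> dcell i x) \<le> w i) \<and>
      (\<forall>x\<in>S. \<exists>i\<ge>j. sat f i x)"
      by (intro exI[of _ f']) blast
  qed simp
  then obtain f where "\<forall>y. 0 \<le> f y" "\<forall>i x. 0 \<le> i \<longrightarrow> i \<le> m \<longrightarrow> sum f (S \<inter> dcell i x) \<le> w i"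
      "\<forall>x\<in>S. \<exists>i\<ge>0. sat f i x" by (elim exE conjE)
  then have f: "\<And>y. 0 \<le> f y" "\<And>i x. i \<le> m \<Longrightarrow> sum f (S \<inter> dcell i x) \<le> w i"
      "\<And>x. x \<in> S \<Longrightarrow> \<exists>i. sat f i x" by blast+
  \<comment> \<open>The least level gives the largest saturated cell through a point; by
    \<open>L_eq\<close> below two such cells are equal or share no point of
    \<open>S\<close>.\<close>
  define L where "L x = (LEAST i. sat f i x)" for x
  define g where "g x = (L x, dcell (L x) x)" for x
  have L: "sat f (L x) x" if "x \<in> S" for x
    unfolding L_def using f(3)[OF that] by (rule LeastI_ex)
  have sat_cong: "sat f i x \<longleftrightarrow> sat f i y" if "x \<in> dcell i y" for i x y
    using that by (simp add: sat_def dcell_eq)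
  have L_eq: "L x = L y" if "x \<in> S" "y \<in> S" "x \<in> dcell (L y) y" for x y
  proof (rule antisym)
    show "L x \<le> L y"
      unfolding L_def[of x] using L[OF that(2)] sat_cong[OF that(3)] by (intro Least_le) simp
    then have "y \<in> dcell (L x) x"
      using that(3) dcell_antimono[of "L x" "L y" x] dcell_eq dcell_self by blast
    then show "L y \<le> L x"
      unfolding L_def[of y] using L[OF that(1)] sat_cong[of y "L x" x] by (intro Least_le) simp
  qed
  have "dcovers (g ` S) E"
    unfolding dcovers_def
  proof
    fix x assume "x \<in> E"
    then obtain y where y: "y \<in> S" "dcell m x = dcell m y" using S(3) by (metis imageE imageI)
    have "L y \<le> m" using L[OF y(1)] by (simp add: sat_def)
    then have "x \<in> dcell (L y) y" using dcell_antimono[of "L y" m y] dcell_self[of x m] y(2) by auto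
    then have "(L y, dcell (L y) x) = g y" by (simp add: g_def dcell_eq)
    then show "\<exists>j. (j, dcell j x) \<in> g ` S" using y(1) by (metis imageI)
  qed
  then have "dcontent p E \<le> dweight p (g ` S)" by (rule dcontent_le)
  also have "\<dots> = ennreal (\<Sum>(i, Q)\<in>g ` S. w i)"
    using fin by (simp add: dweight_finite w_def)
  \<comment> \<open>Saturation exchanges the weight of each chosen cell for the mass in it, and
    these cells partition \<open>S\<close>.\<close>
  also have "(\<Sum>(i, Q)\<in>g ` S. w i) = (\<Sum>c\<in>g ` S. \<Sum>x | x \<in> S \<and> g x = c. f x)"
  proof (rule sum.cong[OF refl])
    fix c assume "c \<in> g ` S"
    then obtain y where y: "y \<in> S" "c = g y" by blast
    have "{x. x \<in> S \<and> g x = c} = S \<inter> dcell (L y) y"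
    proof
      show "{x. x \<in> S \<and> g x = c} \<subseteq> S \<inter> dcell (L y) y" unfolding y g_def by force
      show "S \<inter> dcell (L y) y \<subseteq> {x. x \<in> S \<and> g x = c}"
      proof
        fix x assume "x \<in> S \<inter> dcell (L y) y"
        then have "x \<in> S" "L x = L y" "dcell (L y) x = dcell (L y) y"
          using L_eq[OF _ y(1)] by (simp_all add: dcell_eq)
        then show "x \<in> {x. x \<in> S \<and> g x = c}" by (simp add: y g_def)
      qed
    qed
    then show "(case c of (i, Q) \<Rightarrow> w i) = (\<Sum>x | x \<in> S \<and> g x = c. f x)"
      using L[OF y(1)] by (simp add: sat_def y g_def)
  qed
  also have "\<dots> = sum f S" using sum.image_gen[OF fin, of f g] by simp
  finally have "dcontent p E \<le> ennreal (sum f S)" .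
  then show ?thesis using f(1,2) fin S(1) by (intro exI[of _ S] exI[of _ f]) (simp add: w_def)
qed

text \<open>A discrete Frostman probability measure. The ball condition stops at radius
  \<open>(1/2) ^ m\<close>, because point masses violate it at small radii when \<open>p\<close> is
  positive.\<close>

definition frostman :: "real \<Rightarrow> real \<Rightarrow> nat \<Rightarrow> 'a::metric_space set \<Rightarrow> ('a \<Rightarrow> real) \<Rightarrow> bool" where
  "frostman C p m S f \<longleftrightarrow> finite S \<and> (\<forall>y. 0 \<le> f y) \<and> sum f S = 1 \<and>
     (\<forall>z r. (1/2) ^ m \<le> r \<longrightarrow> sum f {y\<in>S. dist y z \<le> r} \<le> C * r powr p)"

lemma dyadic_scale:
  fixes r :: real
  assumes "0 < r" "r \<le> 1"
  obtains j where "(1/2) ^ Suc j < r" "r \<le> (1/2) ^ j"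
proof -
  obtain n where n: "(1/2) ^ n < r" using real_arch_pow_inv[of r "1/2"] assms by auto
  define k where "k = (LEAST n. (1/2) ^ n < r)"
  have k: "(1/2) ^ k < r" unfolding k_def using n by (rule LeastI)
  then obtain j where "k = Suc j" using assms by (cases k) auto
  moreover have "r \<le> (1/2) ^ j"
    using not_less_Least[of j "\<lambda>n. (1/2) ^ n < r"] \<open>k = Suc j\<close> by (simp add: k_def not_less)
  ultimately show thesis using that k by blast
qed

lemma dyadic_scale_le:
  fixes r :: real
  assumes "(1/2) ^ m \<le> r" "r \<le> (1/2) ^ j"
  shows "j \<le> m"
proof (rule ccontr)
  assume "\<not> j \<le> m"
  then have "(1/2::real) ^ j < (1/2) ^ m" by (intro power_strict_decreasing) auto
  then show False using assms by linarith
qed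

text \<open>Fatness bounds the total mass below by the same \<open>\<eta>\<close> on every
  neighbourhood, so normalising costs a factor independent of \<open>U\<close> and
  \<open>m\<close>.\<close>

lemma fat_frostman:
  fixes K :: "'a::euclidean_space set"
  assumes "fat p K" "compact K" "0 < p"
  obtains C where "0 < C" "\<And>U m. open U \<Longrightarrow> K \<subseteq> U \<Longrightarrow> \<exists>S f. S \<subseteq> U \<and> frostman C p m S f"
proof -
  obtain \<eta> where \<eta>: "0 < \<eta>" "\<And>U. open U \<Longrightarrow> K \<subseteq> U \<Longrightarrow> ennreal \<eta> \<le> dcontent p U"
    using assms(1) unfolding fat_def by blast
  obtain R where R: "K \<subseteq> ball 0 R"
    using compact_imp_bounded[OF assms(2)] bounded_subset_ballD[of K 0] by blast
  \<comment> \<open>A ball meets at most \<open>3 ^ DIM('a)\<close> cells of comparable size,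
    \<open>2 powr p\<close> pays for rounding the radius to a dyadic one, and the summand 1 takes
    care of radii above 1.\<close>
  define C where "C = 3 ^ DIM('a) * 2 powr p / \<eta> + 1"
  have C: "1 \<le> C" using \<eta> by (simp add: C_def)
  show thesis
  proof
    show "0 < C" using C by simp
    fix U m assume U: "open (U :: 'a set)" "K \<subseteq> U"
    have "bounded (U \<inter> ball 0 R)" by (simp add: bounded_Int)
    from dyadic_frostman[OF this, of m p] obtain S f where
      "finite S \<and> S \<subseteq> U \<inter> ball 0 R \<and> (\<forall>y. 0 \<le> f y) \<and>
      (\<forall>j x. j \<le> m \<longrightarrow> sum f (S \<inter> dcell j x) \<le> ((1/2) ^ j) powr p) \<and>
      dcontent p (U \<inter> ball 0 R) \<le> ennreal (sum f S)" by (elim exE)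
    then have S: "finite S" "S \<subseteq> U \<inter> ball 0 R" "\<And>y. 0 \<le> f y"
      "\<And>j x. j \<le> m \<Longrightarrow> sum f (S \<inter> dcell j x) \<le> ((1/2) ^ j) powr p"
      "dcontent p (U \<inter> ball 0 R) \<le> ennreal (sum f S)" by simp_all
    have "ennreal \<eta> \<le> dcontent p (U \<inter> ball 0 R)"
      by (rule \<eta>(2)) (use U R in auto)
    also note S(5)
    finally have "ennreal \<eta> \<le> ennreal (sum f S)" .
    moreover have "0 \<le> sum f S" using S(3) by (simp add: sum_nonneg)
    ultimately have tot: "\<eta> \<le> sum f S" by simp
    define f' where "f' y = f y / sum f S" for y
    have f': "0 \<le> f' y" for y using tot \<eta>(1) S(3) by (simp add: f'_def)
    have sum1: "sum f' S = 1"
      using tot \<eta>(1) by (simp add: f'_def sum_divide_distrib[symmetric])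
    have "sum f' {y\<in>S. dist y z \<le> r} \<le> C * r powr p" if r: "(1/2) ^ m \<le> r" for z r
    proof (cases "r \<le> 1")
      case False
      have "sum f' {y\<in>S. dist y z \<le> r} \<le> sum f' S" using S(1) f' by (intro sum_mono2) auto
      also have "\<dots> \<le> 1 * r powr p" using sum1 False assms(3) by (simp add: ge_one_powr_ge_zero)
      also have "\<dots> \<le> C * r powr p" using C by (intro mult_right_mono) auto
      finally show ?thesis .
    next
      case True
      have "0 < r" using r zero_less_power[of "1/2::real" m] by linarith
      then obtain j where j: "(1/2) ^ Suc j < r" "r \<le> (1/2) ^ j" by (rule dyadic_scale[OF _ True])
      have "j \<le> m" using dyadic_scale_le[OF r j(2)] .
      let ?T = "{y\<in>S. dist y z \<le> r}"
      have sub: "dcell j ` ?T \<subseteq> dcell j ` cball z ((1/2) ^ j)"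
        using j(2) by (intro image_mono) (auto simp: dist_commute)
      have "sum f' ?T = (\<Sum>Q\<in>dcell j ` ?T. \<Sum>x | x \<in> ?T \<and> dcell j x = Q. f' x)"
        using S(1) by (intro sum.image_gen) auto
      also have "\<dots> \<le> (\<Sum>Q\<in>dcell j ` ?T. ((1/2) ^ j) powr p / \<eta>)"
      proof (rule sum_mono)
        fix Q assume "Q \<in> dcell j ` ?T"
        then obtain y where y: "Q = dcell j y" by blast
        have "(\<Sum>x | x \<in> ?T \<and> dcell j x = Q. f' x) \<le> sum f' (S \<inter> dcell j y)"
          using S(1) f' dcell_self[of _ j] by (intro sum_mono2) (auto simp: y)
        also have "\<dots> = sum f (S \<inter> dcell j y) / sum f S"
          by (simp add: f'_def sum_divide_distrib)
        also have "\<dots> \<le> ((1/2) ^ j) powr p / \<eta>"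
          using S(3) tot \<eta>(1) S(4)[OF \<open>j \<le> m\<close>, of y] by (intro frac_le) (auto simp: sum_nonneg)
        finally show "(\<Sum>x | x \<in> ?T \<and> dcell j x = Q. f' x) \<le> ((1/2) ^ j) powr p / \<eta>" .
      qed
      also have "\<dots> = real (card (dcell j ` ?T)) * (((1/2) ^ j) powr p / \<eta>)" by simp
      also have "\<dots> \<le> 3 ^ DIM('a) * ((2 * r) powr p / \<eta>)"
      proof (rule mult_mono)
        have "card (dcell j ` ?T) \<le> card (dcell j ` cball z ((1/2) ^ j))"
          using sub by (intro card_mono finite_dcells_bounded) auto
        also note card_dcells_cball
        finally have "card (dcell j ` ?T) \<le> 3 ^ DIM('a)" .
        then show "real (card (dcell j ` ?T)) \<le> 3 ^ DIM('a)"
          by (metis of_nat_le_iff of_nat_numeral of_nat_power)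
        show "((1/2) ^ j) powr p / \<eta> \<le> (2 * r) powr p / \<eta>"
          using j(1) assms(3) \<eta>(1) by (intro divide_right_mono powr_mono2) auto
      qed (use \<eta>(1) in auto)
      also have "\<dots> = 3 ^ DIM('a) * 2 powr p / \<eta> * r powr p"
        using \<open>0 < r\<close> by (simp add: powr_mult)
      also have "\<dots> \<le> C * r powr p" by (intro mult_right_mono) (auto simp: C_def)
      finally show ?thesis .
    qed
    then have "S \<subseteq> U \<and> frostman C p m S f'"
      using S(1,2) f' sum1 by (auto simp: frostman_def)
    then show "\<exists>S f. S \<subseteq> U \<and> frostman C p m S f" by blast
  qed
qed

text \<open>A Riesz potential truncated at the scale of the measure. The shell at distance about
  \<open>(1/2) ^ j\<close> has mass of order \<open>((1/2) ^ j) powr p\<close>, so its contributions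
  form a geometric series with ratio \<open>2 powr (q - p)\<close>.\<close>

lemma frostman_potential_le:
  fixes z :: "'a::metric_space"
  assumes fr: "frostman C p m S f" and q: "0 < q" "q < p" and "0 < C"
  shows "(\<Sum>y\<in>S. f y * max (dist y z) ((1/2) ^ m) powr (- q)) \<le> 1 + C * 2 powr q / (1 - 2 powr (q - p))"
proof -
  have S: "finite S" "\<And>y. 0 \<le> f y" "sum f S = 1"
    "\<And>z r. (1/2) ^ m \<le> r \<Longrightarrow> sum f {y\<in>S. dist y z \<le> r} \<le> C * r powr p"
    using fr by (auto simp: frostman_def)
  \<comment> \<open>The kernel at the inner radius of a dyadic shell; this is the source of the
    factor \<open>2 powr q\<close>.\<close>
  define e where "e j = ((1/2::real) ^ Suc j) powr (- q)" for j
  have e: "0 \<le> e j" for j by (simp add: e_def)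
  have pt: "max (dist y z) ((1/2) ^ m) powr (- q) \<le> 1 + (\<Sum>j\<le>m. if dist y z \<le> (1/2) ^ j then e j else 0)"
    (is "?t powr _ \<le> 1 + ?R") for y
  proof (cases "1 \<le> ?t")
    case True
    then have "?t powr (- q) \<le> 1" using q(1) by (simp add: powr_minus_divide ge_one_powr_ge_zero)
    moreover have "0 \<le> ?R" using e by (intro sum_nonneg) auto
    ultimately show ?thesis by simp
  next
    case False
    have "0 < ?t" "?t \<le> 1" using False by (simp_all only: less_max_iff_disj) auto
    then obtain j where j: "(1/2) ^ Suc j < ?t" "?t \<le> (1/2) ^ j" by (rule dyadic_scale)
    have "j \<le> m" using dyadic_scale_le[OF _ j(2)] by simp
    have "?t powr (- q) \<le> e j"
      unfolding e_def using j(1) q(1) by (intro powr_mono2') auto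
    also have "\<dots> = (if dist y z \<le> (1/2) ^ j then e j else 0)" using j(2) by simp
    also have "\<dots> \<le> ?R"
      using \<open>j \<le> m\<close> e by (intro member_le_sum[of j "{..m}" "\<lambda>j. if dist y z \<le> (1/2) ^ j then e j else 0"]) auto
    finally show ?thesis by simp
  qed
  define x where "x = (2::real) powr (q - p)"
  have x: "0 < x" "x < 1" using q by (auto simp: x_def powr_less_one)
  have "(\<Sum>y\<in>S. f y * max (dist y z) ((1/2) ^ m) powr (- q)) \<le>
      (\<Sum>y\<in>S. f y * (1 + (\<Sum>j\<le>m. if dist y z \<le> (1/2) ^ j then e j else 0)))"
    using pt S(2) by (intro sum_mono mult_left_mono) auto
  also have "\<dots> = sum f S + (\<Sum>y\<in>S. \<Sum>j\<le>m. e j * (if dist y z \<le> (1/2) ^ j then f y else 0))"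
    unfolding distrib_left sum.distrib sum_distrib_left
    by (intro arg_cong2[of _ _ _ _ "(+)"] sum.cong) auto
  also have "(\<Sum>y\<in>S. \<Sum>j\<le>m. e j * (if dist y z \<le> (1/2) ^ j then f y else 0)) =
      (\<Sum>j\<le>m. e j * sum f {y\<in>S. dist y z \<le> (1/2) ^ j})"
    unfolding sum.swap[of _ "{..m}"] sum_distrib_left[symmetric]
    using S(1) by (simp add: sum.inter_filter)
  also have "\<dots> \<le> (\<Sum>j\<le>m. C * 2 powr q * x ^ j)"
  proof (rule sum_mono)
    fix j assume "j \<in> {..m}"
    then have "e j * sum f {y\<in>S. dist y z \<le> (1/2) ^ j} \<le> e j * (C * ((1/2) ^ j) powr p)"
      using e by (intro mult_left_mono S(4) power_decreasing) auto
    also have "\<dots> = C * (e j * ((1/2) ^ j) powr p)" by simp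
    also have "e j * ((1/2) ^ j) powr p = 2 powr q * x ^ j"
    proof -
      have h: "(1/2::real) ^ k = 2 powr (- real k)" for k
        by (simp add: powr_minus powr_realpow power_one_over inverse_eq_divide)
      have "e j * ((1/2) ^ j) powr p = 2 powr (q * real (Suc j) + (- real j * p))"
        unfolding e_def h powr_powr powr_add by (simp add: algebra_simps)
      also have "q * real (Suc j) + (- real j * p) = q + (q - p) * real j" by (simp add: algebra_simps)
      also have "2 powr (q + (q - p) * real j) = 2 powr q * x ^ j"
        by (simp add: powr_add x_def powr_powr[symmetric] powr_realpow)
      finally show ?thesis .
    qed
    finally show "e j * sum f {y\<in>S. dist y z \<le> (1/2) ^ j} \<le> C * 2 powr q * x ^ j" by simp
  qed
  also have "\<dots> = C * 2 powr q * (\<Sum>j\<le>m. x ^ j)" by (simp add: sum_distrib_left)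
  also have "\<dots> \<le> C * 2 powr q * (1 / (1 - x))"
  proof (rule mult_left_mono)
    have "(\<Sum>j\<le>m. x ^ j) = (1 - x ^ Suc m) / (1 - x)"
      using x by (simp add: sum_gp0)
    also have "\<dots> \<le> 1 / (1 - x)" using x by (intro divide_right_mono) auto
    finally show "(\<Sum>j\<le>m. x ^ j) \<le> 1 / (1 - x)" .
  qed (use \<open>0 < C\<close> in simp)
  finally show ?thesis using S(3) by (simp add: x_def)
qed

section \<open>Energies and coverings\<close>

text \<open>Here \<open>t\<close> will be the distance of two points and \<open>g a\<close> the
  distance of their directions seen from \<open>a\<close>. In the first case of \<open>g\<close> the
  bound is immediate; in the second, \<open>g\<close> can be small only near \<open>z\<close>, and
  the average is the potential of the measure at \<open>z\<close>.\<close>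

lemma kaufman_sum_le:
  fixes S :: "'a::metric_space set"
  assumes fr: "frostman C p m S f" and q: "0 < q" "q < p" and "0 < C"
    and \<kappa>: "0 < \<kappa>" "\<kappa> \<le> 1" "\<kappa> * t \<le> 1" and "0 \<le> t"
    and g: "(\<forall>a\<in>S. \<kappa> * t \<le> g a) \<or> (\<exists>z. \<forall>a\<in>S. \<kappa> * t * dist a z \<le> g a)"
  shows "(\<Sum>a\<in>S. f a * max (g a) ((1/2) ^ m) powr (- q)) \<le>
    \<kappa> powr (- q) * (1 + C * 2 powr q / (1 - 2 powr (q - p))) * max t ((1/2) ^ m) powr (- q)"
proof -
  define \<delta> where "\<delta> = (1/2::real) ^ m"
  define P where "P = 1 + C * 2 powr q / (1 - 2 powr (q - p))"
  have \<delta>: "0 < \<delta>" by (simp add: \<delta>_def)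
  have x: "2 powr (q - p) < (1::real)" using q by (simp add: powr_less_one)
  then have P: "1 \<le> P" using \<open>0 < C\<close> by (simp add: P_def)
  have k1: "1 \<le> \<kappa> powr (- q)"
    using \<kappa> q powr_mono2'[of "- q" \<kappa> 1] by simp
  have f: "0 \<le> f a" "sum f S = 1" for a using fr by (auto simp: frostman_def)
  have const: "(\<Sum>a\<in>S. f a * max (g a) \<delta> powr (- q)) \<le> \<kappa> powr (- q) * P * max t \<delta> powr (- q)"
    if le: "\<And>a. a \<in> S \<Longrightarrow> \<kappa> * max t \<delta> \<le> max (g a) \<delta>"
  proof -
    have "(\<Sum>a\<in>S. f a * max (g a) \<delta> powr (- q)) \<le> (\<Sum>a\<in>S. f a * (\<kappa> * max t \<delta>) powr (- q))"
      using le q(1) \<delta> \<kappa>(1) f(1) by (intro sum_mono mult_left_mono powr_mono2') (auto simp: less_max_iff_disj)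
    also have "\<dots> = (\<kappa> * max t \<delta>) powr (- q)" using f(2) by (simp add: sum_distrib_right[symmetric])
    also have "\<dots> = \<kappa> powr (- q) * 1 * max t \<delta> powr (- q)"
      using \<kappa>(1) \<open>0 \<le> t\<close> \<delta> by (simp add: powr_mult)
    also have "\<dots> \<le> \<kappa> powr (- q) * P * max t \<delta> powr (- q)"
      using P by (intro mult_mono) auto
    finally show ?thesis .
  qed
  have "\<kappa> * \<delta> \<le> \<delta>" using \<kappa> \<delta> by simp
  have "(\<Sum>a\<in>S. f a * max (g a) \<delta> powr (- q)) \<le> \<kappa> powr (- q) * P * max t \<delta> powr (- q)"
    using g
  proof
    assume "\<forall>a\<in>S. \<kappa> * t \<le> g a"
    then have "\<kappa> * max t \<delta> \<le> max (g a) \<delta>" if "a \<in> S" for a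
      using that \<open>\<kappa> * \<delta> \<le> \<delta>\<close> by (auto simp: max_def split: if_splits)
    then show ?thesis by (rule const)
  next
    assume "\<exists>z. \<forall>a\<in>S. \<kappa> * t * dist a z \<le> g a"
    then obtain z where z: "\<And>a. a \<in> S \<Longrightarrow> \<kappa> * t * dist a z \<le> g a" by blast
    show ?thesis
    proof (cases "t < \<delta>")
      case True
      then have "\<kappa> * max t \<delta> \<le> max (g a) \<delta>" for a
        using \<open>\<kappa> * \<delta> \<le> \<delta>\<close> by (auto simp: max_def)
      then show ?thesis by (rule const)
    next
      case False
      then have t: "0 < t" "max t \<delta> = t" using \<delta> by auto
      have le: "\<kappa> * t * max (dist a z) \<delta> \<le> max (g a) \<delta>" if "a \<in> S" for a
      proof -
        \<comment> \<open>\<open>\<kappa> * t \<le> 1\<close> keeps the rescaled truncation below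
          \<delta>.\<close>
        have "\<kappa> * t * \<delta> \<le> 1 * \<delta>" using \<kappa>(3) \<delta> by (intro mult_right_mono) auto
        then show ?thesis using z[OF that] by (auto simp: max_def)
      qed
      have "(\<Sum>a\<in>S. f a * max (g a) \<delta> powr (- q)) \<le>
          (\<Sum>a\<in>S. f a * (\<kappa> * t * max (dist a z) \<delta>) powr (- q))"
        using le q(1) \<delta> t(1) \<kappa>(1) f(1) by (intro sum_mono mult_left_mono powr_mono2') (auto simp: less_max_iff_disj)
      also have "\<dots> = (\<Sum>a\<in>S. (\<kappa> * t) powr (- q) * (f a * max (dist a z) \<delta> powr (- q)))"
      proof (rule sum.cong[OF refl])
        fix a
        have "(\<kappa> * t * max (dist a z) \<delta>) powr (- q) = (\<kappa> * t) powr (- q) * max (dist a z) \<delta> powr (- q)"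
          using \<kappa>(1) t(1) \<delta> by (intro powr_mult)
        then show "f a * (\<kappa> * t * max (dist a z) \<delta>) powr (- q) =
          (\<kappa> * t) powr (- q) * (f a * max (dist a z) \<delta> powr (- q))" by (simp only: mult.left_commute)
      qed
      also have "\<dots> = (\<kappa> * t) powr (- q) * (\<Sum>a\<in>S. f a * max (dist a z) \<delta> powr (- q))"
        by (rule sum_distrib_left[symmetric])
      also have "\<dots> \<le> (\<kappa> * t) powr (- q) * P"
        unfolding P_def \<delta>_def using frostman_potential_le[OF fr q \<open>0 < C\<close>]
        by (intro mult_left_mono) auto
      also have "\<dots> = \<kappa> powr (- q) * P * max t \<delta> powr (- q)"
        using \<kappa>(1) t by (simp add: powr_mult)
      finally show ?thesis .
    qed
  qed
  then show ?thesis by (simp only: \<delta>_def P_def)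
qed

text \<open>The energy bound and Markov's inequality discard at most half of the mass of the pairs, so that the
  potential \<open>V a b\<close> is bounded on the remaining pairs. For these, the points \<open>b\<close> whose \<open>\<pi> a b\<close> lies in a set of
  diameter \<open>r\<close> have mass at most a multiple of \<open>r powr q\<close>.\<close>

lemma frostman_cover_bound:
  fixes S :: "'a::metric_space set" and T :: "'b::metric_space set" and \<pi> :: "'a \<Rightarrow> 'b \<Rightarrow> 'c::metric_space"
  assumes frS: "frostman C p m S f" and frT: "frostman C' q' m T g"
    and C: "0 < C" "0 < C'" and q: "0 < q" "q < q'" and B: "0 < B"
    and energy: "\<And>b b'. b \<in> T \<Longrightarrow> b' \<in> T \<Longrightarrow>
      (\<Sum>a\<in>S. f a * max (dist (\<pi> a b) (\<pi> a b')) ((1/2) ^ m) powr (- q)) \<le>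
        B * max (dist b b') ((1/2) ^ m) powr (- q)"
    and "finite I"
    and cover: "\<And>a b. a \<in> S \<Longrightarrow> b \<in> T \<Longrightarrow> \<exists>i\<in>I. (a, \<pi> a b) \<in> G i"
    and diam: "\<And>i x y. i \<in> I \<Longrightarrow> x \<in> G i \<Longrightarrow> y \<in> G i \<Longrightarrow> dist x y \<le> d i"
    and d: "\<And>i. i \<in> I \<Longrightarrow> (1/2) ^ m \<le> d i"
  shows "1/2 \<le> C * (2 * B * (1 + C' * 2 powr q / (1 - 2 powr (q - q')))) * (\<Sum>i\<in>I. d i powr (p + q))"
proof -
  define \<delta> where "\<delta> = (1/2::real) ^ m"
  define P where "P = 1 + C' * 2 powr q / (1 - 2 powr (q - q'))"
  \<comment> \<open>Twice the average of \<open>V\<close>, so Markov's inequality discards at most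
    half.\<close>
  define M where "M = 2 * B * P"
  have \<delta>: "0 < \<delta>" by (simp add: \<delta>_def)
  have x: "2 powr (q - q') < (1::real)" using q by (simp add: powr_less_one)
  then have P: "1 \<le> P" using C by (simp add: P_def)
  then have M: "0 < M" using B by (simp add: M_def)
  have f: "finite S" "\<And>a. 0 \<le> f a" "sum f S = 1"
    "\<And>z r. \<delta> \<le> r \<Longrightarrow> sum f {y\<in>S. dist y z \<le> r} \<le> C * r powr p"
    using frS by (auto simp: frostman_def \<delta>_def)
  have g: "finite T" "\<And>a. 0 \<le> g a" "sum g T = 1"
    using frT by (auto simp: frostman_def)
  define k where "k a b b' = max (dist (\<pi> a b) (\<pi> a b')) \<delta> powr (- q)" for a b b'
  have k: "0 \<le> k a b b'" for a b b' by (simp add: k_def)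
  define V where "V a b = (\<Sum>b'\<in>T. g b' * k a b b')" for a b
  have V: "0 \<le> V a b" for a b using g(2) k by (simp add: V_def sum_nonneg)
  have "(\<Sum>b\<in>T. g b * (\<Sum>a\<in>S. f a * V a b)) \<le> (\<Sum>b\<in>T. g b * (B * P))"
  proof (intro sum_mono mult_left_mono g(2))
    fix b assume b: "b \<in> T"
    have "(\<Sum>a\<in>S. f a * V a b) = (\<Sum>a\<in>S. \<Sum>b'\<in>T. g b' * (f a * k a b b'))"
      unfolding V_def sum_distrib_left by (simp only: mult.left_commute)
    also have "\<dots> = (\<Sum>b'\<in>T. \<Sum>a\<in>S. g b' * (f a * k a b b'))" by (rule sum.swap)
    also have "\<dots> = (\<Sum>b'\<in>T. g b' * (\<Sum>a\<in>S. f a * k a b b'))" by (simp only: sum_distrib_left)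
    also have "\<dots> \<le> (\<Sum>b'\<in>T. g b' * (B * max (dist b' b) \<delta> powr (- q)))"
      using energy[OF b] g(2) unfolding k_def \<delta>_def
      by (intro sum_mono mult_left_mono) (auto simp: dist_commute)
    also have "\<dots> = B * (\<Sum>b'\<in>T. g b' * max (dist b' b) \<delta> powr (- q))"
      by (simp only: sum_distrib_left mult.left_commute)
    also have "\<dots> \<le> B * P"
      unfolding P_def \<delta>_def using frostman_potential_le[OF frT q C(2)] B
      by (intro mult_left_mono) auto
    finally show "(\<Sum>a\<in>S. f a * V a b) \<le> B * P" .
  qed
  also have "\<dots> = B * P" using g(3) by (simp only: sum_distrib_right[symmetric])
  finally have en: "(\<Sum>b\<in>T. g b * (\<Sum>a\<in>S. f a * V a b)) \<le> B * P" .
  define good where "good a b = (if V a b \<le> M then 1 else 0::real)" for a b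
  have "1 = (\<Sum>b\<in>T. g b * (\<Sum>a\<in>S. f a))" using f(3) g(3) by simp
  also have "\<dots> \<le> (\<Sum>b\<in>T. g b * (\<Sum>a\<in>S. f a * good a b + f a * V a b * (1 / M)))"
  proof (intro sum_mono mult_left_mono g(2))
    fix a b
    \<comment> \<open>Markov's inequality pointwise, before integration.\<close>
    have "1 \<le> good a b + V a b * (1 / M)" using V[of a b] M by (auto simp: good_def)
    from mult_left_mono[OF this f(2)[of a]] show "f a \<le> f a * good a b + f a * V a b * (1 / M)"
      by (simp add: distrib_left)
  qed
  also have "\<dots> = (\<Sum>b\<in>T. g b * (\<Sum>a\<in>S. f a * good a b)) + (\<Sum>b\<in>T. g b * (\<Sum>a\<in>S. f a * V a b)) * (1 / M)"
    unfolding sum.distrib distrib_left sum_distrib_right[symmetric] mult.assoc[symmetric] ..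
  also have "\<dots> \<le> (\<Sum>b\<in>T. g b * (\<Sum>a\<in>S. f a * good a b)) + B * P * (1 / M)"
    using en M by (intro add_left_mono mult_right_mono) auto
  also have "B * P * (1 / M) = 1/2" using B P by (simp add: M_def)
  finally have half: "1/2 \<le> (\<Sum>b\<in>T. g b * (\<Sum>a\<in>S. f a * good a b))" by simp
  define hit where "hit i a b = (if (a, \<pi> a b) \<in> G i then good a b else 0)" for i a b
  have good0: "0 \<le> good a b" for a b by (simp add: good_def)
  have "(\<Sum>b\<in>T. g b * (\<Sum>a\<in>S. f a * good a b)) \<le> (\<Sum>b\<in>T. g b * (\<Sum>a\<in>S. f a * (\<Sum>i\<in>I. hit i a b)))"
  proof (intro sum_mono mult_left_mono g(2) f(2))
    fix a b assume "a \<in> S" "b \<in> T"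
    then obtain i where i: "i \<in> I" "(a, \<pi> a b) \<in> G i" using cover by blast
    have "good a b = hit i a b" using i by (simp add: hit_def)
    also have "\<dots> \<le> (\<Sum>i\<in>I. hit i a b)"
      using i \<open>finite I\<close> good0 by (intro member_le_sum[of i I "\<lambda>i. hit i a b"]) (auto simp: hit_def)
    finally show "good a b \<le> (\<Sum>i\<in>I. hit i a b)" .
  qed
  also have "\<dots> = (\<Sum>i\<in>I. \<Sum>a\<in>S. f a * (\<Sum>b\<in>T. g b * hit i a b))"
  proof -
    have "(\<Sum>b\<in>T. g b * (\<Sum>a\<in>S. f a * (\<Sum>i\<in>I. hit i a b))) = (\<Sum>b\<in>T. \<Sum>a\<in>S. \<Sum>i\<in>I. f a * (g b * hit i a b))"
      by (simp only: sum_distrib_left mult.left_commute)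
    also have "\<dots> = (\<Sum>a\<in>S. \<Sum>b\<in>T. \<Sum>i\<in>I. f a * (g b * hit i a b))" by (rule sum.swap)
    also have "\<dots> = (\<Sum>a\<in>S. \<Sum>i\<in>I. \<Sum>b\<in>T. f a * (g b * hit i a b))"
      by (intro sum.cong refl sum.swap)
    also have "\<dots> = (\<Sum>i\<in>I. \<Sum>a\<in>S. \<Sum>b\<in>T. f a * (g b * hit i a b))" by (rule sum.swap)
    finally show ?thesis by (simp only: sum_distrib_left)
  qed
  \<comment> \<open>For one covering set: its first projection has diameter at most
    \<open>d i\<close>, hence mass at most \<open>C * d i powr p\<close>, and every fibre has good
    mass at most \<open>M * d i powr q\<close>.\<close>
  also have "\<dots> \<le> (\<Sum>i\<in>I. C * M * d i powr (p + q))"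
  proof (rule sum_mono)
    fix i assume i: "i \<in> I"
    have di: "\<delta> \<le> d i" using d[OF i] by (simp add: \<delta>_def)
    then have "0 < d i" using \<delta> by linarith
    note di = di this
    define A where "A = {a\<in>S. \<exists>b\<in>T. (a, \<pi> a b) \<in> G i}"
    have N: "(\<Sum>b\<in>T. g b * hit i a b) \<le> M * d i powr q" for a
    proof (cases "\<exists>b\<in>T. hit i a b \<noteq> 0")
      case False
      then have "(\<Sum>b\<in>T. g b * hit i a b) = 0" by (intro sum.neutral) auto
      then show ?thesis using M by simp
    next
      case True
      then obtain b0 where b0: "b0 \<in> T" "(a, \<pi> a b0) \<in> G i" "V a b0 \<le> M"
        by (auto simp: hit_def good_def split: if_splits)
      \<comment> \<open>All hits in the fibre over \<open>a\<close> have directions within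
        \<open>d i\<close> of that of \<open>b0\<close>, where the kernel is at least
        \<open>d i powr (- q)\<close>. So the bounded potential at the single good point
        \<open>b0\<close> controls their mass.\<close>
      have "(\<Sum>b\<in>T. g b * hit i a b) \<le> (\<Sum>b\<in>T. d i powr q * (g b * k a b0 b))"
      proof (rule sum_mono)
        fix b
        have "hit i a b \<le> d i powr q * k a b0 b"
        proof (cases "(a, \<pi> a b) \<in> G i")
          case True
          have "dist (\<pi> a b0) (\<pi> a b) \<le> dist (a, \<pi> a b0) (a, \<pi> a b)"
            by (simp add: dist_Pair_Pair)
          also have "\<dots> \<le> d i" using diam[OF i b0(2) True] .
          finally have "max (dist (\<pi> a b0) (\<pi> a b)) \<delta> \<le> d i" using di by simp
          then have "d i powr (- q) \<le> k a b0 b"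
            unfolding k_def using q(1) \<delta> by (intro powr_mono2') (auto simp: less_max_iff_disj)
          then have "d i powr q * d i powr (- q) \<le> d i powr q * k a b0 b"
            by (intro mult_left_mono) auto
          moreover have "d i powr q * d i powr (- q) = 1"
            using di(2) by (simp add: powr_add[symmetric])
          ultimately show ?thesis using True by (auto simp: hit_def good_def)
        qed (use k in \<open>simp add: hit_def\<close>)
        from mult_left_mono[OF this g(2)[of b]]
        show "g b * hit i a b \<le> d i powr q * (g b * k a b0 b)" by (simp only: mult.left_commute)
      qed
      also have "\<dots> = d i powr q * V a b0" by (simp only: V_def sum_distrib_left)
      also have "\<dots> \<le> d i powr q * M" using b0(3) by (intro mult_left_mono) auto
      finally show ?thesis by (simp only: mult.commute)
    qed
    have "(\<Sum>a\<in>S. f a * (\<Sum>b\<in>T. g b * hit i a b)) = (\<Sum>a\<in>A. f a * (\<Sum>b\<in>T. g b * hit i a b))"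
    proof (rule sum.mono_neutral_right)
      show "\<forall>a\<in>S - A. f a * (\<Sum>b\<in>T. g b * hit i a b) = 0"
        by (auto simp: A_def hit_def intro!: sum.neutral disjI2)
    qed (use f(1) in \<open>auto simp: A_def\<close>)
    also have "\<dots> \<le> (\<Sum>a\<in>A. f a * (M * d i powr q))"
      using N f(2) by (intro sum_mono mult_left_mono)
    also have "\<dots> = sum f A * (M * d i powr q)" by (simp only: sum_distrib_right)
    also have "\<dots> \<le> (C * d i powr p) * (M * d i powr q)"
    proof (rule mult_right_mono)
      show "sum f A \<le> C * d i powr p"
      proof (cases "A = {}")
        case False
        then obtain a0 b0 where a0: "a0 \<in> S" "(a0, \<pi> a0 b0) \<in> G i" by (auto simp: A_def)
        have "A \<subseteq> {y\<in>S. dist y a0 \<le> d i}"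
        proof
          fix a assume "a \<in> A"
          then obtain b where ab: "a \<in> S" "(a, \<pi> a b) \<in> G i" by (auto simp: A_def)
          have "dist a a0 \<le> dist (a, \<pi> a b) (a0, \<pi> a0 b0)"
            using dist_fst_le[of "(a, \<pi> a b)" "(a0, \<pi> a0 b0)"] by simp
          also have "\<dots> \<le> d i" using diam[OF i ab(2) a0(2)] .
          finally show "a \<in> {y\<in>S. dist y a0 \<le> d i}" using ab by simp
        qed
        then have "sum f A \<le> sum f {y\<in>S. dist y a0 \<le> d i}"
          using f(1,2) by (intro sum_mono2) auto
        also have "\<dots> \<le> C * d i powr p" by (rule f(4)[OF di(1)])
        finally show ?thesis .
      qed (use C in simp)
    qed (use M in simp)
    also have "\<dots> = C * M * d i powr (p + q)" by (simp add: powr_add)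
    finally show "(\<Sum>a\<in>S. f a * (\<Sum>b\<in>T. g b * hit i a b)) \<le> C * M * d i powr (p + q)" .
  qed
  also have "\<dots> = C * M * (\<Sum>i\<in>I. d i powr (p + q))" by (simp only: sum_distrib_left)
  finally show ?thesis using half by (simp add: M_def P_def)
qed

section \<open>Directions towards a set off a hyperplane\<close>

text \<open>The line through a point \<open>a\<close> of the hyperplane \<open>{x. e \<bullet> x = h}\<close> and a point \<open>b\<close> off it is recorded by \<open>a\<close> and
  its direction vector \<open>v\<close> with \<open>e \<bullet> v = 1\<close>.\<close>

definition rproj :: "'a::real_inner \<Rightarrow> real \<Rightarrow> 'a \<Rightarrow> 'a \<Rightarrow> 'a" where
  "rproj e h a b = (1 / (e \<bullet> b - h)) *\<^sub>R (b - a)"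

text \<open>With \<open>u = b / \<beta>\<close> and \<open>w = 1 / \<beta>\<close> the difference of the directions is \<open>(u - u') - (w - w') a\<close>, affine in \<open>a\<close>:
  it is either bounded below, or controlled by the distance from \<open>a\<close> to its zero \<open>z\<close>.\<close>

lemma rproj_separation:
  fixes b b' e :: "'a::real_inner"
  assumes R: "1 \<le> R" "norm b' \<le> R" and pos: "0 < e \<bullet> b - h" "0 < e \<bullet> b' - h"
    and T: "e \<bullet> b - h \<le> T"
    and \<kappa>: "0 < \<kappa>" "\<kappa> \<le> 1 / (4 * R * (T * R))"
  shows "(\<forall>a. norm a \<le> R \<longrightarrow> \<kappa> * dist b b' \<le> dist (rproj e h a b) (rproj e h a b')) \<or>
    (\<exists>z. \<forall>a. norm a \<le> R \<longrightarrow> \<kappa> * dist b b' * dist a z \<le> dist (rproj e h a b) (rproj e h a b'))"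
proof -
  define \<beta> \<beta>' where "\<beta> = e \<bullet> b - h" and "\<beta>' = e \<bullet> b' - h"
  have \<beta>: "0 < \<beta>" "0 < \<beta>'" "\<beta> \<le> T" using assms by (simp_all add: \<beta>_def \<beta>'_def)
  define x where "x = (1 / \<beta>) *\<^sub>R b - (1 / \<beta>') *\<^sub>R b'"
  define y where "y = 1 / \<beta> - 1 / \<beta>'"
  define s where "s = norm x + \<bar>y\<bar>"
  have s0: "0 \<le> s" by (simp add: s_def)
  have diff: "dist (rproj e h a b) (rproj e h a b') = norm (x - y *\<^sub>R a)" for a
    unfolding rproj_def dist_norm \<beta>_def[symmetric] \<beta>'_def[symmetric] x_def y_def
    by (simp add: algebra_simps)
  \<comment> \<open>Recovers the points from \<open>(u, w)\<close>: this gives the factor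
    \<open>T * R\<close> in the bound on \<kappa>.\<close>
  have "b - b' = \<beta> *\<^sub>R (x - y *\<^sub>R b')"
    using \<beta> by (simp add: x_def y_def algebra_simps)
  then have "dist b b' = \<beta> * norm (x - y *\<^sub>R b')" using \<beta> by (simp add: dist_norm)
  also have "\<dots> \<le> T * (R * s)"
  proof (rule mult_mono)
    have "norm (x - y *\<^sub>R b') \<le> norm x + \<bar>y\<bar> * norm b'"
      using norm_triangle_ineq4[of x "y *\<^sub>R b'"] by simp
    also have "\<dots> \<le> R * norm x + \<bar>y\<bar> * R"
      using R by (intro add_mono mult_left_mono) (auto simp: mult_le_cancel_right1)
    finally show "norm (x - y *\<^sub>R b') \<le> R * s" by (simp add: s_def algebra_simps)
  qed (use \<beta> in auto)
  finally have db: "dist b b' \<le> T * R * s" by simp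
  have "0 < T" using \<beta> by linarith
  have ds: "\<kappa> * dist b b' \<le> s / (4 * R)"
  proof -
    have "\<kappa> * dist b b' \<le> 1 / (4 * R * (T * R)) * (T * R * s)"
      using \<kappa> db \<open>0 < T\<close> R(1) by (intro mult_mono) auto
    also have "\<dots> = s / (4 * R)" using \<open>0 < T\<close> R by (simp add: field_simps)
    finally show ?thesis .
  qed
  \<comment> \<open>If \<open>norm x\<close> dominates, \<open>y *\<^sub>R a\<close> cannot cancel
    it for \<open>norm a \<le> R\<close>. Otherwise \<open>\<bar>y\<bar>\<close> is comparable to
    \<open>s\<close>, and the zero is \<open>x / y\<close>.\<close>
  show ?thesis
  proof (cases "2 * R * \<bar>y\<bar> \<le> norm x")
    case True
    have "\<kappa> * dist b b' \<le> norm (x - y *\<^sub>R a)" if a: "norm a \<le> R" for a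
    proof -
      have "\<bar>y\<bar> * norm a \<le> \<bar>y\<bar> * R" using a by (intro mult_left_mono) auto
      moreover have "norm x - \<bar>y\<bar> * norm a \<le> norm (x - y *\<^sub>R a)"
        using norm_triangle_ineq2[of x "y *\<^sub>R a"] by simp
      moreover have "\<bar>y\<bar> * 1 \<le> \<bar>y\<bar> * R" using R by (intro mult_left_mono) auto
      ultimately have "s / 4 \<le> norm (x - y *\<^sub>R a)" using True by (simp add: s_def algebra_simps)
      moreover have "s / (4 * R) \<le> s / 4" using R s0 by (intro divide_left_mono) auto
      ultimately show ?thesis using ds by simp
    qed
    then show ?thesis by (auto simp: diff)
  next
    case False
    then have y: "y \<noteq> 0" by auto
    have sy: "s / (4 * R) \<le> \<bar>y\<bar>"
    proof -
      have "\<bar>y\<bar> * 1 \<le> \<bar>y\<bar> * R" using R by (intro mult_left_mono) auto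
      then have "s \<le> \<bar>y\<bar> * (4 * R)" using False by (simp add: s_def algebra_simps)
      then show ?thesis using R by (simp add: pos_divide_le_eq)
    qed
    have "\<kappa> * dist b b' * dist a ((1 / y) *\<^sub>R x) \<le> norm (x - y *\<^sub>R a)" for a
    proof -
      have "x - y *\<^sub>R a = (- y) *\<^sub>R (a - (1 / y) *\<^sub>R x)" using y by (simp add: algebra_simps)
      then have "norm (x - y *\<^sub>R a) = \<bar>y\<bar> * dist a ((1 / y) *\<^sub>R x)" by (simp add: dist_norm)
      moreover have "\<kappa> * dist b b' * dist a ((1 / y) *\<^sub>R x) \<le> \<bar>y\<bar> * dist a ((1 / y) *\<^sub>R x)"
        using ds sy by (intro mult_right_mono) auto
      ultimately show ?thesis by simp
    qed
    then show ?thesis unfolding diff by blast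
  qed
qed

lemma exists_dyadic_below:
  assumes "finite I" "\<And>i. i \<in> I \<Longrightarrow> 0 < (d i :: real)"
  obtains m where "\<And>i. i \<in> I \<Longrightarrow> (1/2) ^ m \<le> d i"
proof -
  have "0 < Min (insert 1 (d ` I))" using assms by (subst Min_gr_iff) auto
  then obtain m where m: "(1/2) ^ m < Min (insert 1 (d ` I))"
    using real_arch_pow_inv[of _ "1/2"] by auto
  have "(1/2) ^ m \<le> d i" if "i \<in> I" for i
    using m Min_le[of "insert 1 (d ` I)" "d i"] assms(1) that by auto
  then show thesis using that by blast
qed

text \<open>The tube lemma in both factors. The Frostman points lie only near \<open>K\<close> and
  near \<open>L\<close>, so the cover has to reach a product neighbourhood.\<close>

lemma compact_Times_nhds:
  fixes K :: "'a::metric_space set" and L :: "'b::metric_space set"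
  assumes "compact K" "compact L" "open W" "K \<times> L \<subseteq> W"
  obtains U V where "open U" "open V" "K \<subseteq> U" "L \<subseteq> V" "U \<times> V \<subseteq> W"
proof -
  have "compact (K \<times> L)" using assms by (simp add: compact_Times)
  then obtain \<epsilon> where \<epsilon>: "0 < \<epsilon>" "(\<Union>z\<in>K \<times> L. ball z \<epsilon>) \<subseteq> W"
    using compact_subset_open_imp_ball_epsilon_subset assms(3,4) by metis
  show thesis
  proof (rule that)
    let ?U = "\<Union>x\<in>K. ball x (\<epsilon> / 2)" and ?V = "\<Union>y\<in>L. ball y (\<epsilon> / 2)"
    show "open ?U" "open ?V" by auto
    show "K \<subseteq> ?U" "L \<subseteq> ?V" using \<epsilon>(1) by force+
    show "?U \<times> ?V \<subseteq> W"
    proof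
      fix z assume "z \<in> ?U \<times> ?V"
      then obtain x y a b where z: "z = (a, b)" "x \<in> K" "y \<in> L" "dist x a < \<epsilon> / 2" "dist y b < \<epsilon> / 2"
        by auto
      have "dist (x, y) (a, b) \<le> dist x a + dist y b"
        by (simp add: dist_Pair_Pair sqrt_sum_squares_le_sum)
      then have "z \<in> ball (x, y) \<epsilon>" using z by simp
      then have "z \<in> (\<Union>z\<in>K \<times> L. ball z \<epsilon>)" using z(2,3) by blast
      then show "z \<in> W" using \<epsilon>(2) by blast
    qed
  qed
qed

text \<open>The constant \<open>M\<close> is independent of the scale and of the neighbourhoods. So
  the cover, of total at most \<open>1 / (4 * M)\<close>, can be fixed before both, against the
  lower bound \<open>1 / (2 * M)\<close> from \<open>frostman_cover_bound\<close>.\<close>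

theorem not_hnull_rproj_image:
  fixes K L :: "'a::euclidean_space set"
  assumes K: "compact K" "fat p K" and L: "compact L" "fat q' L"
    and pos: "\<And>b. b \<in> L \<Longrightarrow> h < e \<bullet> b"
    and q: "0 < q" "q < p" "q < q'"
  shows "\<not> hnull dist (p + q) ((\<lambda>(a, b). (a, rproj e h a b)) ` (K \<times> L))"
proof
  define \<Phi> where "\<Phi> = (\<lambda>(a, b). (a, rproj e h a b))"
  assume "hnull dist (p + q) ((\<lambda>(a, b). (a, rproj e h a b)) ` (K \<times> L))"
  then have null: "hnull dist (p + q) (\<Phi> ` (K \<times> L))" by (simp add: \<Phi>_def)
  have pq: "0 < p" "0 < q'" "0 < p + q" using q by auto
  obtain C where C: "0 < C" "\<And>U m. open U \<Longrightarrow> K \<subseteq> U \<Longrightarrow> \<exists>S f. S \<subseteq> U \<and> frostman C p m S f"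
    using fat_frostman[OF K(2,1) pq(1)] by blast
  obtain C' where C': "0 < C'" "\<And>U m. open U \<Longrightarrow> L \<subseteq> U \<Longrightarrow> \<exists>S f. S \<subseteq> U \<and> frostman C' q' m S f"
    using fat_frostman[OF L(2,1) pq(2)] by blast
  have "bounded (K \<union> L)" using K(1) L(1) by (simp add: compact_imp_bounded)
  then obtain R0 where R0: "K \<union> L \<subseteq> ball 0 R0" using bounded_subset_ballD by blast
  define R where "R = max 1 R0"
  have R: "1 \<le> R" "K \<subseteq> ball 0 R" "L \<subseteq> ball 0 R" using R0 by (auto simp: R_def)
  define T where "T = norm e * R + \<bar>h\<bar> + 1"
  have T: "0 < T" using R by (simp add: T_def add_nonneg_pos)
  \<comment> \<open>The first term is required by \<open>rproj_separation\<close>; the second gives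
    \<open>\<kappa> * dist b b' \<le> 1\<close> in the ball of radius \<open>R\<close>.\<close>
  define \<kappa> where "\<kappa> = min (1 / (4 * R * (T * R))) (1 / (2 * R))"
  have \<kappa>: "0 < \<kappa>" "\<kappa> \<le> 1 / (4 * R * (T * R))" "\<kappa> \<le> 1 / (2 * R)"
    using R T by (simp_all add: \<kappa>_def)
  have "1 / (2 * R) \<le> 1" using R by simp
  then have \<kappa>1: "\<kappa> \<le> 1" using \<kappa>(3) by linarith
  define B where "B = \<kappa> powr (- q) * (1 + C * 2 powr q / (1 - 2 powr (q - p)))"
  have B: "0 < B"
  proof -
    have "2 powr (q - p) < (1::real)" using q by (simp add: powr_less_one)
    then show ?thesis using C(1) \<kappa>(1) by (simp add: B_def add_pos_nonneg)
  qed
  define M where "M = C * (2 * B * (1 + C' * 2 powr q / (1 - 2 powr (q - q'))))"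
  have M: "0 < M"
  proof -
    have "2 powr (q - q') < (1::real)" using q by (simp add: powr_less_one)
    then show ?thesis using C(1) C'(1) B by (simp add: M_def add_pos_nonneg)
  qed
  have "0 < 1 / (4 * M)" using M by simp
  then obtain G d where G: "\<Phi> ` (K \<times> L) \<subseteq> (\<Union>i::nat. G i)" "\<And>i. open (G i)" "\<And>i. 0 < d i"
    "\<And>i x y. x \<in> G i \<Longrightarrow> y \<in> G i \<Longrightarrow> dist x y \<le> d i"
    "\<And>I. finite I \<Longrightarrow> (\<Sum>i\<in>I. d i powr (p + q)) \<le> 1 / (4 * M)"
    using hnull_open_cover[OF null pq(3)] by metis
  \<comment> \<open>An open set around \<open>K \<times> L\<close> on which the points stay bounded
    and \<open>\<Phi>\<close> is continuous.\<close>
  define Dom :: "('a \<times> 'a) set" where "Dom = ball 0 R \<times> (ball 0 R \<inter> {b. h < e \<bullet> b})"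
  have "open {b. h < e \<bullet> b}" by (rule open_halfspace_gt)
  then have "open Dom" unfolding Dom_def by (intro open_Times open_Int open_ball)
  have cont: "continuous_on Dom \<Phi>"
    unfolding \<Phi>_def case_prod_unfold rproj_def by (intro continuous_intros) (auto simp: Dom_def)
  have KL: "K \<times> L \<subseteq> Dom" using R pos by (auto simp: Dom_def)
  have "compact (\<Phi> ` (K \<times> L))"
    using K(1) L(1) by (intro compact_continuous_image continuous_on_subset[OF cont KL] compact_Times)
  then obtain I where I: "finite I" "\<Phi> ` (K \<times> L) \<subseteq> (\<Union>i\<in>I. G i)"
    using G(1,2) compactE_image[of "\<Phi> ` (K \<times> L)" UNIV G] by (metis UNIV_I)
  define W where "W = Dom \<inter> \<Phi> -` (\<Union>i\<in>I. G i)"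
  have "open W"
    unfolding W_def using cont \<open>open Dom\<close> G(2) by (intro continuous_open_preimage) auto
  moreover have "K \<times> L \<subseteq> W" using KL I(2) unfolding W_def by blast
  ultimately obtain U V where UV: "open U" "open V" "K \<subseteq> U" "L \<subseteq> V" "U \<times> V \<subseteq> W"
    by (rule compact_Times_nhds[OF K(1) L(1)])
  obtain m where m: "\<And>i. i \<in> I \<Longrightarrow> (1/2) ^ m \<le> d i"
    using exists_dyadic_below[OF I(1)] G(3) by metis
  obtain S f where S: "S \<subseteq> U" "frostman C p m S f" using C(2)[OF UV(1,3)] by blast
  obtain Q g where Q: "Q \<subseteq> V" "frostman C' q' m Q g" using C'(2)[OF UV(2,4)] by blast
  have "S \<noteq> {}" "Q \<noteq> {}" using S(2) Q(2) by (auto simp: frostman_def)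
  then have SQ: "norm a < R" "norm b < R" "h < e \<bullet> b" "\<Phi> (a, b) \<in> (\<Union>i\<in>I. G i)" if "a \<in> S" "b \<in> Q" for a b
  proof -
    have "(a, b) \<in> W" using that S(1) Q(1) UV(5) by blast
    then show "norm a < R" "norm b < R" "h < e \<bullet> b" "\<Phi> (a, b) \<in> (\<Union>i\<in>I. G i)"
      by (auto simp: W_def Dom_def)
  qed
  have energy: "(\<Sum>a\<in>S. f a * max (dist (rproj e h a b) (rproj e h a b')) ((1/2) ^ m) powr (- q)) \<le>
        B * max (dist b b') ((1/2) ^ m) powr (- q)" if b: "b \<in> Q" "b' \<in> Q" for b b'
    unfolding B_def
  proof (rule kaufman_sum_le[OF S(2) q(1,2) C(1) \<kappa>(1) \<kappa>1])
    obtain a0 where "a0 \<in> S" using \<open>S \<noteq> {}\<close> by blast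
    note b' = SQ[OF \<open>a0 \<in> S\<close> b(1)] SQ[OF \<open>a0 \<in> S\<close> b(2)]
    have "dist b b' \<le> norm b + norm b'" unfolding dist_norm by (rule norm_triangle_ineq4)
    also have "\<dots> \<le> 2 * R" using b' by simp
    finally have "\<kappa> * dist b b' \<le> 1 / (2 * R) * (2 * R)"
      using \<kappa>(1,3) R(1) by (intro mult_mono) auto
    then show "\<kappa> * dist b b' \<le> 1" using R(1) by simp
    have "e \<bullet> b \<le> norm e * norm b" by (rule norm_cauchy_schwarz)
    also have "\<dots> \<le> norm e * R" using b'(2) by (intro mult_left_mono) auto
    finally have "e \<bullet> b - h \<le> T" by (simp add: T_def)
    then have "(\<forall>a. norm a \<le> R \<longrightarrow> \<kappa> * dist b b' \<le> dist (rproj e h a b) (rproj e h a b')) \<or>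
      (\<exists>z. \<forall>a. norm a \<le> R \<longrightarrow> \<kappa> * dist b b' * dist a z \<le> dist (rproj e h a b) (rproj e h a b'))"
      using b' R(1) \<kappa>(1,2) by (intro rproj_separation) auto
    moreover have "norm a \<le> R" if "a \<in> S" for a using SQ(1)[OF that b(1)] by simp
    ultimately show "(\<forall>a\<in>S. \<kappa> * dist b b' \<le> dist (rproj e h a b) (rproj e h a b')) \<or>
      (\<exists>z. \<forall>a\<in>S. \<kappa> * dist b b' * dist a z \<le> dist (rproj e h a b) (rproj e h a b'))" by blast
  qed simp
  have "1/2 \<le> M * (\<Sum>i\<in>I. d i powr (p + q))"
    unfolding M_def
  proof (rule frostman_cover_bound[OF S(2) Q(2) C(1) C'(1) q(1,3) B energy I(1)])
    show "\<exists>i\<in>I. (a, rproj e h a b) \<in> G i" if "a \<in> S" "b \<in> Q" for a b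
      using SQ(4)[OF that] by (auto simp: \<Phi>_def)
  qed (use G(4) m in auto)
  also have "\<dots> \<le> M * (1 / (4 * M))" using G(5)[OF I(1)] M by (intro mult_left_mono) auto
  also have "\<dots> = 1/4" using M by simp
  finally show False by simp
qed

section \<open>The space of lines\<close>

lemma orthogonal_comp_span_singleton:
  "x \<in> (span {v})\<^sup>\<bottom> \<longleftrightarrow> v \<bullet> x = 0"
proof
  assume "x \<in> (span {v})\<^sup>\<bottom>"
  then have "orthogonal v x"
    unfolding orthogonal_comp_def using span_base[of v "{v}"] by simp
  then show "v \<bullet> x = 0" by (simp add: orthogonal_def)
next
  assume "v \<bullet> x = 0"
  then show "x \<in> (span {v})\<^sup>\<bottom>"
    by (auto simp: orthogonal_comp_def orthogonal_def span_singleton)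
qed

text \<open>Expresses \<open>v\<close> and \<open>a\<close> through the data entering
  \<open>plane_dist\<close>: projecting \<open>e\<close> to the line direction gives
  \<open>v / (v \<bullet> v)\<close>, and \<open>a\<close> is where the line meets the
  hyperplane.\<close>

lemma line_decomposition:
  fixes a v e :: "'a::euclidean_space"
  assumes "e \<bullet> v = 1" "e \<bullet> a = h"
  defines "l \<equiv> (+) a ` span {v}"
  shows "l \<in> affine_planes 1" "orth_proj (plane_dir l) e = (1 / (v \<bullet> v)) *\<^sub>R v"
    "a = plane_offset l + (h - e \<bullet> plane_offset l) *\<^sub>R v" "norm (plane_offset l) \<le> norm a"
proof -
  have v: "v \<noteq> 0" using assms(1) by auto
  define s where "s = (v \<bullet> a) / (v \<bullet> v)"
  define x where "x = a - s *\<^sub>R v"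
  have vx: "v \<bullet> x = 0" using v by (simp add: x_def s_def inner_diff_right)
  then have xW: "x \<in> (span {v})\<^sup>\<bottom>" by (simp add: orthogonal_comp_span_singleton)
  have sv: "s *\<^sub>R v \<in> span {v}" by (simp add: span_base span_scale)
  have l: "l = (+) x ` span {v}"
  proof
    show "l \<subseteq> (+) x ` span {v}"
    proof
      fix y assume "y \<in> l"
      then obtain w where w: "w \<in> span {v}" "y = a + w" by (auto simp: l_def)
      then have "y = x + (s *\<^sub>R v + w)" by (simp add: x_def)
      then show "y \<in> (+) x ` span {v}" using span_add[OF sv w(1)] by blast
    qed
    show "(+) x ` span {v} \<subseteq> l"
    proof
      fix y assume "y \<in> (+) x ` span {v}"
      then obtain w where w: "w \<in> span {v}" "y = x + w" by auto
      then have "y = a + (w - s *\<^sub>R v)" by (simp add: x_def)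
      then show "y \<in> l" using span_diff[OF w(1) sv] unfolding l_def by blast
    qed
  qed
  have "dim (span {v}) = 1" using v by (simp add: dim_span dim_singleton)
  then show "l \<in> affine_planes 1"
    unfolding affine_planes_iff using xW l subspace_span by blast
  have dir: "plane_dir l = span {v}" unfolding l by (rule plane_dir_translation[OF subspace_span])
  have off: "plane_offset l = x"
    unfolding l by (rule plane_offset_translation[OF subspace_span xW])
  show "orth_proj (plane_dir l) e = (1 / (v \<bullet> v)) *\<^sub>R v"
    unfolding dir
  proof (rule orth_proj_eqI[OF subspace_span])
    show "(1 / (v \<bullet> v)) *\<^sub>R v \<in> span {v}" by (simp add: span_base span_scale)
    show "e - (1 / (v \<bullet> v)) *\<^sub>R v \<in> (span {v})\<^sup>\<bottom>"
      using assms(1) v by (simp add: orthogonal_comp_span_singleton inner_diff_right inner_commute)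
  qed
  have "e \<bullet> x = h - s" using assms(1,2) by (simp add: x_def inner_diff_right)
  then show "a = plane_offset l + (h - e \<bullet> plane_offset l) *\<^sub>R v"
    by (simp add: off x_def)
  have "norm x * norm x = x \<bullet> a"
    using vx by (simp add: x_def inner_diff_right inner_commute power2_norm_eq_inner[symmetric] flip: power2_eq_square)
      (simp add: power2_norm_eq_inner inner_diff_right inner_diff_left inner_commute x_def)
  also have "\<dots> \<le> norm x * norm a" by (rule norm_cauchy_schwarz)
  finally show "norm (plane_offset l) \<le> norm a"
    unfolding off by (cases "x = 0") simp_all
qed

text \<open>The formulas of \<open>line_decomposition\<close> can be inverted with Lipschitz control
  as long as \<open>v\<close> and \<open>a\<close> are bounded, that is, as long as the line is not
  almost parallel to the hyperplane.\<close>

lemma dist_le_plane_dist: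
  fixes a a' v v' e :: "'a::euclidean_space"
  assumes v: "e \<bullet> v = 1" "e \<bullet> v' = 1" "norm v \<le> V" "norm v' \<le> V"
    and a: "e \<bullet> a = h" "e \<bullet> a' = h" "norm a \<le> R"
  shows "dist (a, v) (a', v') \<le>
    (1 + norm e * V + (1 + (\<bar>h\<bar> + norm e * R)) * (V\<^sup>2 * norm e + V ^ 3 * (norm e)\<^sup>2)) *
      plane_dist ((+) a ` span {v}) ((+) a' ` span {v'})"
proof -
  define l l' where "l = (+) a ` span {v}" and "l' = (+) a' ` span {v'}"
  define x x' where "x = plane_offset l" and "x' = plane_offset l'"
  define D where "D = plane_dist l l'"
  note dec = line_decomposition[OF v(1) a(1), folded l_def] and dec' = line_decomposition[OF v(2) a(2), folded l'_def]
  note bl = bounded_linear_orth_proj_diff[OF subspace_plane_dir[OF dec(1)] subspace_plane_dir[OF dec'(1)]]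
  have V: "0 \<le> V" using v(3) norm_ge_zero order_trans by blast
  have D: "0 \<le> D" unfolding D_def by (rule plane_dist_nonneg[OF dec(1) dec'(1) dec(1)])
  have xx: "norm (x - x') \<le> D"
    unfolding D_def plane_dist_def x_def x'_def using onorm_pos_le[OF bl] by simp
  define w w' where "w = (1 / (v \<bullet> v)) *\<^sub>R v" and "w' = (1 / (v' \<bullet> v')) *\<^sub>R v'"
  have "norm (w - w') \<le> onorm (\<lambda>u. orth_proj (plane_dir l) u - orth_proj (plane_dir l') u) * norm e"
    using onorm[OF bl, of e] by (simp add: dec(2) dec'(2) w_def w'_def)
  also have "\<dots> \<le> D * norm e"
    unfolding D_def plane_dist_def by (intro mult_right_mono) auto
  finally have ww: "norm (w - w') \<le> D * norm e" .
  have nz: "v \<noteq> 0" "v' \<noteq> 0" using v by auto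
  have ew: "e \<bullet> w = 1 / (v \<bullet> v)" "e \<bullet> w' = 1 / (v' \<bullet> v')"
    using v by (simp_all add: w_def w'_def)
  \<comment> \<open>Difference of \<open>w / (e \<bullet> w)\<close> and
    \<open>w' / (e \<bullet> w')\<close>, written with
    \<open>v \<bullet> v = 1 / (e \<bullet> w)\<close>. No denominator remains, so upper bounds on
    \<open>v\<close> and \<open>v'\<close> suffice.\<close>
  have "v - v' = (v \<bullet> v) *\<^sub>R (w - w') - ((v \<bullet> v) * (e \<bullet> (w - w'))) *\<^sub>R v'"
    using nz by (simp add: inner_diff_right ew) (simp add: w_def w'_def algebra_simps)
  also have "norm \<dots> \<le> norm ((v \<bullet> v) *\<^sub>R (w - w')) + norm (((v \<bullet> v) * (e \<bullet> (w - w'))) *\<^sub>R v')"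
    by (rule norm_triangle_ineq4)
  also have "\<dots> = (v \<bullet> v) * norm (w - w') + (v \<bullet> v) * \<bar>e \<bullet> (w - w')\<bar> * norm v'"
    by (simp add: abs_mult)
  also have "\<dots> \<le> V\<^sup>2 * (D * norm e) + V\<^sup>2 * (norm e * (D * norm e)) * V"
  proof -
    have vv: "v \<bullet> v \<le> V\<^sup>2" unfolding power2_norm_eq_inner[symmetric] using v(3) by (intro power_mono) auto
    have "\<bar>e \<bullet> (w - w')\<bar> \<le> norm e * norm (w - w')" by (rule Cauchy_Schwarz_ineq2)
    also have "\<dots> \<le> norm e * (D * norm e)" using ww by (intro mult_left_mono) auto
    finally have "\<bar>e \<bullet> (w - w')\<bar> \<le> norm e * (D * norm e)" .
    then show ?thesis using vv ww v(4) V D by (intro add_mono mult_mono) auto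
  qed
  finally have vv: "norm (v - v') \<le> (V\<^sup>2 * norm e + V ^ 3 * (norm e)\<^sup>2) * D"
    by (simp add: algebra_simps power2_eq_square power3_eq_cube)
  have "a = x + (h - e \<bullet> x) *\<^sub>R v" "a' = x' + (h - e \<bullet> x') *\<^sub>R v'"
    using dec(3) dec'(3) by (simp_all add: x_def x'_def)
  then have "a - a' = (x + (h - e \<bullet> x) *\<^sub>R v) - (x' + (h - e \<bullet> x') *\<^sub>R v')"
    by (rule arg_cong2[where f="(-)"])
  also have "\<dots> = ((x - x') + (h - e \<bullet> x) *\<^sub>R (v - v')) - (e \<bullet> (x - x')) *\<^sub>R v'"
    by (simp add: algebra_simps inner_diff_right)
  also have "norm \<dots> \<le> (norm (x - x') + norm ((h - e \<bullet> x) *\<^sub>R (v - v'))) + norm ((e \<bullet> (x - x')) *\<^sub>R v')"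
    by (intro order_trans[OF norm_triangle_ineq4] add_right_mono norm_triangle_ineq)
  also have "\<dots> = (norm (x - x') + \<bar>h - e \<bullet> x\<bar> * norm (v - v')) + \<bar>e \<bullet> (x - x')\<bar> * norm v'"
    by simp
  also have "\<dots> \<le> (D + (\<bar>h\<bar> + norm e * R) * norm (v - v')) + (norm e * D) * V"
  proof -
    have "\<bar>e \<bullet> x\<bar> \<le> norm e * norm x" by (rule Cauchy_Schwarz_ineq2)
    also have "\<dots> \<le> norm e * R"
      using dec(4) a(3) by (intro mult_left_mono) (auto simp: x_def)
    finally have 1: "\<bar>h - e \<bullet> x\<bar> \<le> \<bar>h\<bar> + norm e * R" by linarith
    have "\<bar>e \<bullet> (x - x')\<bar> \<le> norm e * norm (x - x')" by (rule Cauchy_Schwarz_ineq2)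
    also have "\<dots> \<le> norm e * D" using xx by (intro mult_left_mono) auto
    finally have 2: "\<bar>e \<bullet> (x - x')\<bar> \<le> norm e * D" .
    show ?thesis using 1 2 xx v(4) D by (intro add_mono mult_mono mult_right_mono) auto
  qed
  finally have "norm (a - a') \<le> (D + (\<bar>h\<bar> + norm e * R) * norm (v - v')) + (norm e * D) * V" .
  moreover have "dist (a, v) (a', v') \<le> norm (a - a') + norm (v - v')"
    unfolding dist_norm[symmetric] by (simp add: dist_Pair_Pair sqrt_sum_squares_le_sum)
  ultimately have "dist (a, v) (a', v') \<le>
      (1 + norm e * V) * D + (1 + (\<bar>h\<bar> + norm e * R)) * norm (v - v')"
    by (simp add: algebra_simps)
  also have "\<dots> \<le> (1 + norm e * V) * D +
      (1 + (\<bar>h\<bar> + norm e * R)) * ((V\<^sup>2 * norm e + V ^ 3 * (norm e)\<^sup>2) * D)"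
  proof -
    have "0 \<le> R" using a(3) norm_ge_zero order_trans by blast
    then show ?thesis using vv by (intro add_left_mono mult_left_mono) auto
  qed
  finally show ?thesis by (simp add: D_def l_def l'_def algebra_simps)
qed

text \<open>Lines from \<open>K\<close> to \<open>L\<close> cross the hyperplane transversally,
  uniformly by compactness, so a null cover of the lines would transfer to the pairs (point,
  direction).\<close>

theorem not_hnull_lines:
  fixes X K L :: "'a::euclidean_space set"
  assumes K: "compact K" "fat p K" "K \<subseteq> X" and L: "compact L" "fat q' L" "L \<subseteq> X"
    and flat: "\<And>a. a \<in> K \<Longrightarrow> e \<bullet> a = h" and pos: "\<And>b. b \<in> L \<Longrightarrow> h < e \<bullet> b"
    and q: "0 < q" "q < p" "q < q'"
  shows "\<not> hnull plane_dist (p + q) (lines_through_two_points X)"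
proof
  define \<psi> where "\<psi> = (\<lambda>(a, b). (+) a ` span {rproj e h a b})"
  define \<Phi> where "\<Phi> = (\<lambda>(a, b). (a, rproj e h a b))"
  have unit: "e \<bullet> rproj e h a b = 1" if "a \<in> K" "b \<in> L" for a b
    using flat[OF that(1)] pos[OF that(2)] by (simp add: rproj_def inner_diff_right)
  assume null: "hnull plane_dist (p + q) (lines_through_two_points X)"
  have "\<psi> ` (K \<times> L) \<subseteq> lines_through_two_points X"
  proof
    fix l assume "l \<in> \<psi> ` (K \<times> L)"
    then obtain a b where ab: "a \<in> K" "b \<in> L" "l = (+) a ` span {rproj e h a b}"
      by (auto simp: \<psi>_def)
    have "l \<in> affine_planes 1"
      unfolding ab(3) by (rule line_decomposition(1)[OF unit[OF ab(1,2)] flat[OF ab(1)]])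
    moreover have "a \<in> l" using imageI[OF span_zero[of "{rproj e h a b}"], of "(+) a"] by (simp add: ab(3))
    moreover have "b \<in> l"
    proof -
      have "b = a + (e \<bullet> b - h) *\<^sub>R rproj e h a b" using pos[OF ab(2)] by (simp add: rproj_def)
      moreover have "(e \<bullet> b - h) *\<^sub>R rproj e h a b \<in> span {rproj e h a b}"
        by (simp add: span_base span_scale)
      ultimately show ?thesis unfolding ab(3) by (rule image_eqI)
    qed
    moreover have "a \<noteq> b" using flat[OF ab(1)] pos[OF ab(2)] by auto
    ultimately show "l \<in> lines_through_two_points X"
      using ab(1,2) K(3) L(3) unfolding lines_through_two_points_def by blast
  qed
  with null have null': "hnull plane_dist (p + q) (\<psi> ` (K \<times> L))" by (rule hnull_subset)
  have "continuous_on (K \<times> L) (\<lambda>z. rproj e h (fst z) (snd z))"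
    unfolding rproj_def using pos by (intro continuous_intros) force+
  then have "compact ((\<lambda>z. rproj e h (fst z) (snd z)) ` (K \<times> L))"
    using K(1) L(1) by (intro compact_continuous_image compact_Times)
  then have "bounded ((\<lambda>z. rproj e h (fst z) (snd z)) ` (K \<times> L))" by (rule compact_imp_bounded)
  then obtain V where "\<forall>y\<in>(\<lambda>z. rproj e h (fst z) (snd z)) ` (K \<times> L). norm y \<le> V"
    unfolding bounded_iff by (rule exE)
  then have V: "norm (rproj e h a b) \<le> V" if "a \<in> K" "b \<in> L" for a b
    using that by force
  obtain R where R: "\<forall>a\<in>K. norm a \<le> R"
    using compact_imp_bounded[OF K(1)] unfolding bounded_iff by (rule exE)
  define C where "C = max 1 (1 + norm e * V + (1 + (\<bar>h\<bar> + norm e * R)) * (V\<^sup>2 * norm e + V ^ 3 * (norm e)\<^sup>2))"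
  have "hnull dist (p + q) (\<Phi> ` (K \<times> L))"
  proof (rule hnull_image_lipschitz[OF null'])
    show "0 < C" by (simp add: C_def)
    fix z z' assume z: "z \<in> K \<times> L" "z' \<in> K \<times> L"
    obtain a b a' b' where ab: "z = (a, b)" "z' = (a', b')" by (cases z, cases z')
    have mem: "a \<in> K" "b \<in> L" "a' \<in> K" "b' \<in> L" using z ab by auto
    have "dist (\<Phi> z) (\<Phi> z') \<le>
      (1 + norm e * V + (1 + (\<bar>h\<bar> + norm e * R)) * (V\<^sup>2 * norm e + V ^ 3 * (norm e)\<^sup>2)) *
      plane_dist (\<psi> z) (\<psi> z')"
      unfolding ab \<Phi>_def \<psi>_def prod.case
      using mem R by (intro dist_le_plane_dist unit flat V) simp_all
    also have "\<dots> \<le> C * plane_dist (\<psi> z) (\<psi> z')"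
    proof (rule mult_right_mono)
      have "\<psi> z \<in> affine_planes 1" "\<psi> z' \<in> affine_planes 1"
        unfolding ab \<psi>_def prod.case by (intro line_decomposition(1)[OF unit flat] mem)+
      then show "0 \<le> plane_dist (\<psi> z) (\<psi> z')" by (blast intro: plane_dist_nonneg)
    qed (simp add: C_def)
    finally show "dist (\<Phi> z) (\<Phi> z') \<le> C * plane_dist (\<psi> z) (\<psi> z')" .
  qed (use q in simp)
  then show False
    using not_hnull_rproj_image[OF K(1,2) L(1,2) pos q] by (simp add: \<Phi>_def)
qed

section \<open>The dimension bound\<close>

text \<open>The functionals are plus and minus the coordinates of the component orthogonal to
  \<open>H\<close>. They are finitely many, so the complement of \<open>H\<close> splits into
  finitely many half-space pieces and one of them must retain the dimension.\<close>

lemma separating_functionals: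
  fixes H :: "'a::euclidean_space set"
  assumes "H \<in> affine_planes k"
  obtains E x\<^sub>0 where "finite E" "\<And>e a. e \<in> E \<Longrightarrow> a \<in> H \<Longrightarrow> e \<bullet> a = e \<bullet> x\<^sub>0"
    "\<And>b. b \<notin> H \<Longrightarrow> \<exists>e\<in>E. e \<bullet> x\<^sub>0 < e \<bullet> b"
proof
  define W where "W = plane_dir H"
  define x\<^sub>0 where "x\<^sub>0 = plane_offset H"
  define P where "P = orth_proj W"
  define E where "E = (\<lambda>i. i - P i) ` Basis \<union> (\<lambda>i. P i - i) ` Basis"
  have W: "subspace W" unfolding W_def by (rule subspace_plane_dir[OF assms])
  have H: "H = (+) x\<^sub>0 ` W" unfolding W_def x\<^sub>0_def by (rule plane_eq_translation[OF assms])
  have perp: "w \<bullet> (v - P v) = 0" if "w \<in> W" for v w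
    using orth_proj(2)[OF W, of v] that by (auto simp: P_def orthogonal_comp_def orthogonal_def)
  show "finite E" by (simp add: E_def)
  show "e \<bullet> a = e \<bullet> x\<^sub>0" if e: "e \<in> E" and a: "a \<in> H" for e a
  proof -
    obtain w where "w \<in> W" "a = x\<^sub>0 + w" using a H by auto
    moreover have "(i - P i) \<bullet> w = 0" for i using perp[OF \<open>w \<in> W\<close>, of i] by (simp only: inner_commute)
    ultimately show ?thesis using e by (auto simp: E_def inner_diff_left inner_add_right)
  qed
  show "\<exists>e\<in>E. e \<bullet> x\<^sub>0 < e \<bullet> b" if "b \<notin> H" for b
  proof (rule ccontr)
    assume "\<not> ?thesis"
    then have le: "e \<bullet> (b - x\<^sub>0) \<le> 0" if "e \<in> E" for e
      using that by (auto simp: inner_diff_right not_less)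
    define y where "y = b - x\<^sub>0"
    have "y \<bullet> i = P y \<bullet> i" if i: "i \<in> Basis" for i
    proof -
      have "i - P i \<in> E" "P i - i \<in> E" using i by (simp_all add: E_def)
      then have "(i - P i) \<bullet> y \<le> 0" "(P i - i) \<bullet> y \<le> 0"
        using le by (simp_all only: y_def)
      then have "i \<bullet> y = P i \<bullet> y" by (simp add: inner_diff_left)
      also have "\<dots> = P i \<bullet> P y"
        using perp[of "P i" y] orth_proj(1)[OF W, of i] by (simp add: P_def inner_diff_right)
      also have "\<dots> = i \<bullet> P y"
        using perp[of "P y" i] orth_proj(1)[OF W, of y] by (simp add: P_def inner_diff_right inner_commute)
      finally show ?thesis by (simp only: inner_commute)
    qed
    then have "y = P y" by (rule euclidean_eqI)
    then have "y \<in> W" using orth_proj(1)[OF W, of y] by (simp add: P_def)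
    then have "x\<^sub>0 + y \<in> H" unfolding H by (rule imageI)
    then show False using that by (simp add: y_def)
  qed
qed

lemma closed_affine_plane:
  assumes "H \<in> affine_planes k"
  shows "closed H"
  using assms by (simp add: affine_planes_def affine_closed)

lemma compact_fat_subset_if_not_hnull:
  fixes A :: "'a::euclidean_space set"
  assumes "A \<in> sets borel" "\<not> hnull dist p A" "0 < p"
  obtains K where "compact K" "K \<subseteq> A" "fat p K"
proof -
  have "\<exists>n::nat. \<not> hnull dist p (A \<inter> cball 0 (real n))"
  proof (rule ccontr)
    assume "\<nexists>n::nat. \<not> hnull dist p (A \<inter> cball 0 (real n))"
    then have "hnull dist p (\<Union>n::nat. A \<inter> cball 0 (real n))" by (intro hnull_UN) blast
    moreover have "A \<subseteq> (\<Union>n::nat. A \<inter> cball 0 (real n))"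
    proof
      fix x assume "x \<in> A"
      moreover obtain n :: nat where "norm x \<le> real n" using real_arch_simple by blast
      ultimately have "x \<in> A \<inter> cball 0 (real n)" by simp
      then show "x \<in> (\<Union>n::nat. A \<inter> cball 0 (real n))" by (rule UN_I[OF UNIV_I])
    qed
    ultimately have "hnull dist p A" by (rule hnull_subset)
    then show False using assms(2) by contradiction
  qed
  then obtain n :: nat where n: "\<not> hnull dist p (A \<inter> cball 0 (real n))" by blast
  have "A \<inter> cball 0 (real n) \<in> sets borel" using assms(1) by (intro sets.Int) auto
  moreover have "bounded (A \<inter> cball 0 (real n))" by (simp add: bounded_Int)
  moreover have "dcontent p (A \<inter> cball 0 (real n)) \<noteq> 0"
    using n dcontent_0_imp_hnull[OF _ assms(3)] by blast
  ultimately obtain K where "compact K" "K \<subseteq> A \<inter> cball 0 (real n)" "fat p K"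
    by (rule fat_compact_subset)
  then show thesis by (intro that) auto
qed

text \<open>Any \<open>p\<close> strictly between \<open>max t' (D - t)\<close> and \<open>s\<close>
  works; the case distinctions come from infinite \<open>s\<close> and truncated
  subtraction.\<close>

lemma ennreal_intermediate_exponent:
  fixes s t' D :: ennreal
  assumes "t' < s" "D < s + ennreal t" "0 < t"
  obtains p where "0 < p" "t' < ennreal p" "ennreal p < s" "D < ennreal (p + t)"
proof -
  have "D - ennreal t < s"
  proof (cases "ennreal t \<le> D")
    case True
    have "s \<noteq> 0" using assms(1) by auto
    show ?thesis
    proof (cases "s = top")
      case True
      have "D - ennreal t \<le> D" by (rule diff_le_self_ennreal)
      also have "D < top" using assms(2) by (rule less_le_trans[OF _ top_greatest])
      finally show ?thesis using True by simp
    next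
      case False
      then obtain s' where "s = ennreal s'" "0 \<le> s'" by (cases s) auto
      moreover obtain D' where "D = ennreal D'" "0 \<le> D'" using assms(2) by (cases D) auto
      ultimately show ?thesis using assms(2,3) True
        by (simp add: ennreal_minus ennreal_less_iff flip: ennreal_plus)
    qed
  next
    case False
    then have "D < ennreal t" by simp
    then have "D < top" by (rule less_trans) simp
    with \<open>D < ennreal t\<close> have "D - ennreal t = 0" by (simp add: diff_eq_0_iff_ennreal)
    then show ?thesis using assms(1) by (simp add: order_le_less_trans[OF zero_le])
  qed
  then have "max t' (D - ennreal t) < s" using assms(1) by simp
  then obtain p' where p': "max t' (D - ennreal t) < p'" "p' < s" using dense by blast
  then obtain p where p: "p' = ennreal p" "0 \<le> p"
    by (cases p') auto
  have "0 < p" using p' p by (metis ennreal_less_zero_iff max_less_iff_conj not_less_zero ennreal_eq_0_iff order_le_less)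
  moreover have "D < ennreal (p + t)"
  proof -
    obtain D' where D': "D = ennreal D'" "0 \<le> D'"
    proof (cases D)
      case top
      then show thesis using assms(2) by simp
    qed auto
    then have "ennreal (D' - t) < ennreal p" using p' p assms(3) by (simp add: ennreal_minus)
    then have "D' - t < p" using ennreal_leI[of p "D' - t"] by (meson not_le)
    then show ?thesis using D' by (simp add: ennreal_less_iff)
  qed
  ultimately show thesis using that p' p by auto
qed

theorem theorem4p13:
  fixes X H :: "(real ^ 'n) set" and k :: nat and t :: real
  assumes "2 \<le> CARD('n)"
    and "1 \<le> k" and "k \<le> CARD('n) - 1"
    and "X \<in> sets borel"
    and "H \<in> affine_planes k"
    and "hausdorff_dim dist (X - H) < hausdorff_dim dist X"
    and "0 < t" and "ennreal t \<le> hausdorff_dim dist X"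
    and "\<forall>P \<in> affine_planes k. ennreal t \<le> hausdorff_dim dist (X - P)"
  shows "hausdorff_dim plane_dist (lines_through_two_points X)
           \<ge> hausdorff_dim dist X + ennreal t"
proof (rule ccontr)
  assume "\<not> ?thesis"
  then have "hausdorff_dim plane_dist (lines_through_two_points X) < hausdorff_dim dist X + ennreal t"
    by simp
  \<comment> \<open>\<open>p\<close> above \<open>dim (X - H)\<close> makes that part null, so
    \<open>X \<inter> H\<close> cannot be; \<open>D < p + t\<close> leaves room to replace
    \<open>t\<close> by a smaller exponent.\<close>
  from ennreal_intermediate_exponent[OF assms(6) this assms(7)]
  obtain p where p: "0 < p" "hausdorff_dim dist (X - H) < ennreal p" "ennreal p < hausdorff_dim dist X"
    "hausdorff_dim plane_dist (lines_through_two_points X) < ennreal (p + t)" by blast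
  have tB: "ennreal t \<le> hausdorff_dim dist (X - H)" using assms(5,9) by blast
  then have "ennreal t < ennreal p" using p(2) by (rule order_le_less_trans)
  then have "t < p" using assms(7) by (simp add: ennreal_less_iff)
  obtain D where D: "hausdorff_dim plane_dist (lines_through_two_points X) = ennreal D" "0 \<le> D"
    using p(4) by (cases "hausdorff_dim plane_dist (lines_through_two_points X)") auto
  have "D < p + t" using p(4) D by (simp add: ennreal_less_iff)
  define M where "M = max 0 (D - p)"
  have M: "M < t" "0 \<le> M" "D - p \<le> M" using \<open>D < p + t\<close> assms(7) by (simp_all add: M_def)
  \<comment> \<open>Midpoints: \<open>D < p + q\<close> makes the lines null at exponent
    \<open>p + q\<close>, \<open>q' < t\<close> makes \<open>X - H\<close> not null at exponent
    \<open>q'\<close>, and \<open>q < q'\<close> keeps the potential of the second measure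
    finite.\<close>
  define q where "q = (M + t) / 2"
  define q' where "q' = (q + t) / 2"
  have "0 < q" "M < q" "q < t" using M by (simp_all add: q_def)
  then have q: "0 < q" "q < t" "D < p + q" "q < q'" "q' < t" using M by (simp_all add: q'_def)
  have "0 \<le> plane_dist l l" if "l \<in> lines_through_two_points X" for l :: "(real ^ 'n) set"
  proof -
    have "l \<in> affine_planes 1" using that by (simp add: lines_through_two_points_def)
    then show ?thesis using plane_dist_nonneg by blast
  qed
  then have lines: "hnull plane_dist (p + q) (lines_through_two_points X)"
    using D q(3) by (intro hnull_if_hausdorff_dim_less) (auto simp: ennreal_less_iff)
  have "\<not> hnull dist p (X \<inter> H)"
  proof
    assume "hnull dist p (X \<inter> H)"
    moreover have "hnull dist p (X - H)" using p(2) by (rule hnull_if_hausdorff_dim_less) simp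
    ultimately have "hnull dist p ((X \<inter> H) \<union> (X - H))" using p(1) by (intro hnull_Un)
    then have "hausdorff_dim dist X \<le> ennreal p"
      using p(1) by (intro hausdorff_dim_le_if_hnull) (simp_all add: Int_Diff_Un)
    then show False using p(3) by simp
  qed
  moreover have "X \<inter> H \<in> sets borel"
    using assms(4) borel_closed[OF closed_affine_plane[OF assms(5)]] by (rule sets.Int)
  ultimately obtain K where K: "compact K" "K \<subseteq> X \<inter> H" "fat p K"
    using p(1) by (metis compact_fat_subset_if_not_hnull)
  obtain E x\<^sub>0 where E: "finite E" "\<And>e a. e \<in> E \<Longrightarrow> a \<in> H \<Longrightarrow> e \<bullet> a = e \<bullet> x\<^sub>0"
    "\<And>b. b \<notin> H \<Longrightarrow> \<exists>e\<in>E. e \<bullet> x\<^sub>0 < e \<bullet> b"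
    using separating_functionals[OF assms(5)] by metis
  define B where "B e = X \<inter> {b. e \<bullet> x\<^sub>0 < e \<bullet> b}" for e
  have "\<not> hnull dist q' (X - H)"
  proof
    assume "hnull dist q' (X - H)"
    then have "hausdorff_dim dist (X - H) \<le> ennreal q'"
      using q by (intro hausdorff_dim_le_if_hnull) auto
    also have "\<dots> < ennreal t" using q by (simp add: ennreal_less_iff)
    finally show False using tB by simp
  qed
  moreover have "X - H \<subseteq> (\<Union>e\<in>E. B e)" using E(3) by (auto simp: B_def)
  ultimately have "\<not> hnull dist q' (\<Union>e\<in>E. B e)" using hnull_subset by blast
  moreover have "0 < q'" using q by simp
  ultimately have "\<exists>e\<in>E. \<not> hnull dist q' (B e)"
    using hnull_countable_UN[OF countable_finite[OF E(1)], of dist q' B] by blast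
  then obtain e where e: "e \<in> E" "\<not> hnull dist q' (B e)" by blast
  have "B e \<in> sets borel"
    unfolding B_def using assms(4) borel_open[OF open_halfspace_gt] by (rule sets.Int)
  then obtain L where L: "compact L" "L \<subseteq> B e" "fat q' L"
    using e(2) \<open>0 < q'\<close> by (rule compact_fat_subset_if_not_hnull)
  have "\<not> hnull plane_dist (p + q) (lines_through_two_points X)"
  proof (rule not_hnull_lines)
    show "compact K" "fat p K" "K \<subseteq> X" "compact L" "fat q' L" "L \<subseteq> X"
      using K L unfolding B_def by blast+
    show "e \<bullet> a = e \<bullet> x\<^sub>0" if "a \<in> K" for a using E(2)[OF e(1)] K(2) that by blast
    show "e \<bullet> x\<^sub>0 < e \<bullet> b" if "b \<in> L" for b using L(2) that by (auto simp: B_def)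
  qed (use q \<open>t < p\<close> in auto)
  then show False using lines by contradiction
qed

end
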